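(* Let $c\in[0,1)$, $d\in(0,1]$ with $c+d=1$. Suppose that the sequence of vertex-weighted directed random graphs $\{G(V_n,E_n;\mathscr{A}_n):n\ge1\}$ admits a strong coupling with a marked directed graph which is a (delayed) marked Galton-Watson tree $\mathcal{T}(\boldsymbol{\mathcal{X}})$, and that the conditional law $\nu(\cdot)$ of the external signals given the vertex marks satisfies $d_1(\nu(\mathbf{x}),\nu(\tilde{\mathbf{x}}))\le K\rho(\mathbf{x},\tilde{\mathbf{x}})$ for all $\mathbf{x},\tilde{\mathbf{x}}\in\mathcal{S}$ and some $K<\infty$. Assume the external signals are of the media form $\mathcal{W}_{\mathbf{i}}^{(k)}=d\mathcal{Z}_{\mathbf{i}}^{(k)}+\mathcal{Q}_{\mathbf{i}}\big(c-\sum_{j=1}^{\mathcal{N}_{\mathbf{i}}}\mathcal{C}_{(\mathbf{i},j)}\big)$. If $P(\mathcal{N}_\emptyset>0)=P(\mathcal{N}_1>0)=1$, then the conditional mean and variance of the limiting typical stationary opinion $\mathcal{R}^*$ given the vertex attribute $\boldsymbol{\mathcal{X}}_\emptyset$ of the root are $$E[\mathcal{R}^*\mid\boldsymbol{\mathcal{X}}_\emptyset]=d\,E[\mathcal{Z}_\emptyset\mid\boldsymbol{\mathcal{X}}_\emptyset]+c\,E[\mathcal{Z}_1],$$ $$\mathrm{Var}(\mathcal{R}^*\mid\boldsymbol{\mathcal{X}}_\emptyset)=d^2\,\mathrm{Var}(\mathcal{Z}_\emptyset\mid\boldsymbol{\mathcal{X}}_\emptyset)+\frac{d^2}{1-\rho_2}\sum_{i=1}^{\mathcal{N}_\emptyset}\mathcal{C}_i^2\,\mathrm{Var}(\mathcal{Z}_1),$$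 where $\rho_2=E\big[\sum_{i=1}^{\mathcal{N}_1}\mathcal{C}_{(1,i)}^2\big]$.
   Context: Mark space. $\mathcal{S}=\mathcal{S}'\times[-1,1]\times\{0,1\}\times\mathbb{N}\times[0,1]^\infty$, with $\mathcal{S}'$ a Polish space with metric $\rho'$. For $\mathbf{x}=(\mathbf{a},q,s,d^-,c_11(d^-\ge1),c_21(d^-\ge2),\dots)$ and $\tilde{\mathbf{x}}$ similarly, $$\rho(\mathbf{x},\tilde{\mathbf{x}})=\rho'(\mathbf{a},\tilde{\mathbf{a}})+|q-\tilde q|+|s-\tilde s|+|d^--\tilde d^-|+\sum_{j\ge1}|c_j1(d^-\ge j)-\tilde c_j1(\tilde d^-\ge j)|.$$ $d_1$ is the Wasserstein-1 metric on laws of real random variables. Random graphs. $G(V_n,E_n;\mathscr{A}_n)$ has vertex set $V_n=\{1,\dots,n\}$; vertex $i$ has attribute $\mathbf{Y}_i=(\mathbf{A}_i,Q_i,S_i)\in\mathcal{S}'\times[-1,1]\times\{0,1\}$, $\mathscr{A}_n=\{\mathbf{Y}_i\}$. The edges are random; $D_i^-$ is the in-degree of $i$; weights $C(i,1),\dots,C(i,D_i^-)\in[0,1]$ with sum $c$ (if $D_i^->0$) are sampled afterwards, the weight vectors being conditionally independent given $\mathscr{A}_n$. The full mark is $\mathbf{X}_i=(\mathbf{A}_i,Q_i,S_i,D_i^-,C(i,1)1(D_i^-\ge1),\dots)\in\mathcal{S}$. Opinions on the graph follow $R_i^{(k+1)}=\sum_{r=1}^{D_i^-}C(i,r)R_{L(i,r)}^{(k)}+W_i^{(k)}+(1-c-d)R_i^{(k)}$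 with $L(i,r)$ the $r$th inbound neighbor of $i$ and signals $W_i^{(k)}$ conditionally independent given the marked graph, with $W_i^{(k)}\sim\nu(\mathbf{X}_i)$ and $|W_i^{(k)}|\le d+c-\sum_rC(i,r)$; since $d>0$ there is a unique stationary distribution given the graph. Strong coupling. Multigraphs are isomorphic ($\simeq$) if there is a bijection $\theta$ of the vertex sets preserving numbers of self-loops and numbers of edges between ordered pairs. $G_i^{(k)}(\mathbf{X})$ is the marked induced subgraph on the vertices having a directed path of length at most $k$ to $i$; $G_i^{(k)}$ is the same without marks. $\{G(V_n,E_n;\mathscr{A}_n)\}$ admits a strong coupling with a rooted marked directed graph $\mathcal{G}(\boldsymbol{\mathcal{X}})$ if: (a) for $I_n$ uniform in $V_n$ and any fixed $k\ge1$, $\epsilon>0$, there is a coupling between $G_{I_n}^{(k)}(\mathbf{X})$ and a copy $\mathcal{G}_\emptyset(\boldsymbol{\mathcal{X}})$ of $\mathcal{G}(\boldsymbol{\mathcal{X}})$, with root $\emptyset$ and depth-$k$ in-component of the root $\mathcal{G}_\emptyset^{(k)}$, such that $\mathcal{E}_{I_n}^{(k,\epsilon)}=\{\mathcal{G}_\emptyset^{(k)}\simeq G_{I_n}^{(k)},\ \theta(\emptyset)=I_n,\ \bigcap_{i\in\mathcal{G}_\emptyset^{(k)}}\{\rho(\mathbf{X}_{\theta(i)},\boldsymbol{\mathcal{X}}_i)\le\epsilon\}\}$ satisfies $P(\mathcal{E}_{I_n}^{(k,\epsilon)}\mid\mathscr{A}_n)\xrightarrow{P}1$; (b) given two independent uniform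 vertices $I_n,J_n$ there exist two independent copies of $\mathcal{G}(\boldsymbol{\mathcal{X}})$ such that the corresponding events satisfy $P(\mathcal{E}_{I_n}^{(k,\epsilon)}\cap\mathcal{E}_{J_n}^{(k,\epsilon)}\mid\mathscr{A}_n)\xrightarrow{P}1$ as $n\to\infty$. Tree and $\mathcal{R}^*$. Nodes of the tree are labeled by $\mathbf{i}\in\mathcal{U}=\bigcup_{k\ge0}\mathbb{N}_+^k$, $\mathbb{N}_+^0=\{\emptyset\}$; $|\mathbf{i}|$ is the generation, $(\mathbf{i},j)$ denotes concatenation, and the inbound neighbors of $\mathbf{i}$ are $(\mathbf{i},1),\dots,(\mathbf{i},\mathcal{N}_{\mathbf{i}})$. Marks are $\boldsymbol{\mathcal{X}}_{\mathbf{i}}=(\boldsymbol{\mathcal{A}}_{\mathbf{i}},\mathcal{Q}_{\mathbf{i}},\mathcal{S}_{\mathbf{i}},\mathcal{N}_{\mathbf{i}},\mathcal{C}_{(\mathbf{i},1)}1(\mathcal{N}_{\mathbf{i}}\ge1),\mathcal{C}_{(\mathbf{i},2)}1(\mathcal{N}_{\mathbf{i}}\ge2),\dots)\in\mathcal{S}$, with $\mathcal{C}_{(\mathbf{i},j)}\in[0,1]$ and $\sum_{j=1}^{\mathcal{N}_{\mathbf{i}}}\mathcal{C}_{(\mathbf{i},j)}=c$ if $\mathcal{N}_{\mathbf{i}}>0$. "(Delayed) marked Galton-Watson tree" means that the marks $\{\boldsymbol{\mathcal{X}}_{\mathbf{i}}:\mathbf{i}\in\mathcal{U}\}$ are independent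 and those with $\mathbf{i}\ne\emptyset$ are i.i.d. ($\boldsymbol{\mathcal{X}}_\emptyset$ may have a different law). The media signals $\mathcal{Z}_{\mathbf{i}}^{(k)}\in[-1,1]$ are conditionally independent given $\mathcal{T}(\boldsymbol{\mathcal{X}})$ and, for each $\mathbf{i}$, $\{\mathcal{Z}_{\mathbf{i}}^{(k)}:k\ge0\}$ are conditionally i.i.d. given $\boldsymbol{\mathcal{X}}_{\mathbf{i}}$, so that $\mathcal{W}_{\mathbf{i}}^{(k)}$ has conditional law $\nu(\boldsymbol{\mathcal{X}}_{\mathbf{i}})$; $\mathcal{Z}_\emptyset,\mathcal{Z}_1$ denote generic copies of $\mathcal{Z}_\emptyset^{(k)},\mathcal{Z}_1^{(k)}$. The limiting typical stationary opinion (the limit of the stationary opinion of a uniformly chosen vertex as $n\to\infty$) is $$\mathcal{R}^*=\sum_{s=0}^\infty\sum_{l=0}^s\sum_{|\mathbf{j}|=l}\Pi_{\mathbf{j}}\binom{s}{l}(1-c-d)^{s-l}\mathcal{W}_{\mathbf{j}}^{(s)},\qquad\Pi_\emptyset=1,\ \Pi_{(\mathbf{i},j)}=\Pi_{\mathbf{i}}\mathcal{C}_{(\mathbf{i},j)},$$ (sum over nodes of generation $l$, $0^0=1$), which for $c+d=1$ equals $\sum_{s\ge0}\sum_{|\mathbf{j}|=s}\Pi_{\mathbf{j}}\mathcal{W}_{\mathbf{j}}^{(s)}$. *)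

theory Defs
  imports "HOL-Probability.Probability"
begin

section \<open>Marks\<close>

text \<open>
  A mark is \<open>(a, q, s, m, w)\<close>: extended attribute, internal opinion, stubbornness indicator,
  in-degree (or number of offspring) and sequence of weights. All sequences indexed by
  \<open>{1, 2, ...}\<close> on paper are indexed from \<open>0\<close> here, so \<open>w r\<close> is the weight of the
  \<open>(r+1)\<close>st inbound neighbor and the indicator \<open>1(m \<ge> r+1)\<close> reads \<open>r < m\<close>.
\<close>

type_synonym 'a mark = "'a \<times> real \<times> nat \<times> nat \<times> (nat \<Rightarrow> real)"
type_synonym 'a attribute = "'a \<times> real \<times> nat"

fun mark_attr :: "'a mark \<Rightarrow> 'a attribute" where
  "mark_attr (a, q, s, m, w) = (a, q, s)"

fun mark_opinion :: "'a mark \<Rightarrow> real" where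
  "mark_opinion (a, q, s, m, w) = q"

fun mark_deg :: "'a mark \<Rightarrow> nat" where
  "mark_deg (a, q, s, m, w) = m"

fun mark_weight :: "'a mark \<Rightarrow> nat \<Rightarrow> real" where
  "mark_weight (a, q, s, m, w) = w"

definition mark_space :: "'a mark set" where
  "mark_space = UNIV \<times> {-1..1} \<times> {0, 1} \<times> UNIV \<times> {w. \<forall>r. w r \<in> {0..1}}"

definition mark_algebra :: "'a::polish_space mark measure" where
  "mark_algebra = restrict_space borel mark_space"

text \<open>The series has only finitely many nonzero terms.\<close>

fun mark_dist :: "'a::polish_space mark \<Rightarrow> 'a mark \<Rightarrow> real" where
  "mark_dist (a, q, s, m, w) (a', q', s', m', w') =
     dist a a' + \<bar>q - q'\<bar> + \<bar>real s - real s'\<bar> + \<bar>real m - real m'\<bar>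
     + (\<Sum>r. \<bar>w r * of_bool (r < m) - w' r * of_bool (r < m')\<bar>)"

definition mark_weight_sum :: "'a mark \<Rightarrow> real" where
  "mark_weight_sum x = (\<Sum>r<mark_deg x. mark_weight x r)"

definition valid_mark :: "real \<Rightarrow> 'a mark \<Rightarrow> bool" where
  "valid_mark c x \<longleftrightarrow> x \<in> mark_space \<and> (\<forall>r\<ge>mark_deg x. mark_weight x r = 0)
     \<and> (0 < mark_deg x \<longrightarrow> mark_weight_sum x = c)"


section \<open>Probability\<close>

definition prob_given :: "'w measure \<Rightarrow> 'w measure \<Rightarrow> 'w set \<Rightarrow> 'w \<Rightarrow> real" where
  "prob_given M F A = real_cond_exp M F (indicator A)"

definition cond_variance :: "'w measure \<Rightarrow> 'w measure \<Rightarrow> ('w \<Rightarrow> real) \<Rightarrow> 'w \<Rightarrow> real" where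
  "cond_variance M F f = real_cond_exp M F (\<lambda>x. (f x - real_cond_exp M F f x)\<^sup>2)"

definition cond_indep_vars ::
  "'w measure \<Rightarrow> 'w measure \<Rightarrow> 'b measure \<Rightarrow> ('i \<Rightarrow> 'w \<Rightarrow> 'b) \<Rightarrow> 'i set \<Rightarrow> bool" where
  "cond_indep_vars M F N X I \<longleftrightarrow> (\<forall>i\<in>I. X i \<in> M \<rightarrow>\<^sub>M N) \<and>
     (\<forall>J B. J \<subseteq> I \<and> finite J \<and> J \<noteq> {} \<and> (\<forall>j\<in>J. B j \<in> sets N) \<longrightarrow>
        (AE \<omega> in M. prob_given M F (\<Inter>j\<in>J. X j -` B j \<inter> space M) \<omega>
                  = (\<Prod>j\<in>J. prob_given M F (X j -` B j \<inter> space M) \<omega>)))"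

definition has_cond_law ::
  "'w measure \<Rightarrow> 'w measure \<Rightarrow> 'b measure \<Rightarrow> ('w \<Rightarrow> 'b) \<Rightarrow> ('w \<Rightarrow> 'b measure) \<Rightarrow> bool" where
  "has_cond_law M F N X \<kappa> \<longleftrightarrow> X \<in> M \<rightarrow>\<^sub>M N \<and>
     (\<forall>B\<in>sets N. AE \<omega> in M. prob_given M F (X -` B \<inter> space M) \<omega> = measure (\<kappa> \<omega>) B)"

definition tendsto_in_prob ::
  "(nat \<Rightarrow> 'w measure) \<Rightarrow> (nat \<Rightarrow> 'w \<Rightarrow> real) \<Rightarrow> real \<Rightarrow> bool" where
  "tendsto_in_prob M X l \<longleftrightarrow>
     (\<forall>\<delta>>0. (\<lambda>n. measure (M n) {\<omega> \<in> space (M n). \<bar>X n \<omega> - l\<bar> > \<delta>}) \<longlonglongrightarrow> 0)"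

definition wasserstein1 :: "real measure \<Rightarrow> real measure \<Rightarrow> ennreal" where
  "wasserstein1 \<mu> \<nu> =
     (INF \<pi>\<in>{\<pi>. sets \<pi> = sets (borel \<Otimes>\<^sub>M borel) \<and> distr \<pi> borel fst = \<mu> \<and> distr \<pi> borel snd = \<nu>}.
        \<integral>\<^sup>+ z. ennreal \<bar>fst z - snd z\<bar> \<partial>\<pi>)"


section \<open>Marked directed multigraphs\<close>

text \<open>\<open>edges g u v\<close> is the number of edges from \<open>u\<close> to \<open>v\<close>; \<open>edges g v v\<close> counts self-loops.\<close>

datatype ('v, 'm) mgraph =
  MGraph (verts: "'v set") (edges: "'v \<Rightarrow> 'v \<Rightarrow> nat") (mark: "'v \<Rightarrow> 'm")

text \<open>
  \<open>edges\<close> and \<open>mark\<close> are irrelevant off the vertex set; fixing them there makes the law of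
  a random graph carry no additional information.
\<close>

definition wf_mgraph :: "('v, 'm) mgraph \<Rightarrow> bool" where
  "wf_mgraph g \<longleftrightarrow> (\<forall>u v. u \<notin> verts g \<or> v \<notin> verts g \<longrightarrow> edges g u v = 0)
     \<and> (\<forall>v. v \<notin> verts g \<longrightarrow> mark g v = undefined)"

definition mgraph_algebra :: "('v, 'm::topological_space) mgraph measure" where
  "mgraph_algebra = sigma UNIV
     (range (\<lambda>v. {g. v \<in> verts g})
      \<union> range (\<lambda>(u, v, m). {g. edges g u v = m})
      \<union> {{g. mark g v \<in> B} | v B. B \<in> sets borel})"

text \<open>Vertex set of the depth-\<open>k\<close> in-component of \<open>i\<close>.\<close>

definition in_verts :: "('v, 'm) mgraph \<Rightarrow> 'v \<Rightarrow> nat \<Rightarrow> 'v set" where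
  "in_verts g i k = {v \<in> verts g. \<exists>l\<le>k.
     (v, i) \<in> {(u, w). u \<in> verts g \<and> w \<in> verts g \<and> edges g u w > 0} ^^ l}"

definition mgraph_iso_on ::
  "('v \<Rightarrow> 'u) \<Rightarrow> ('v, 'm) mgraph \<Rightarrow> 'v set \<Rightarrow> ('u, 'k) mgraph \<Rightarrow> 'u set \<Rightarrow> bool" where
  "mgraph_iso_on \<theta> h V g U \<longleftrightarrow> bij_betw \<theta> V U \<and>
     (\<forall>u\<in>V. \<forall>v\<in>V. edges h u v = edges g (\<theta> u) (\<theta> v))"

text \<open>
  The coupling event for the graph \<open>g\<close> with chosen vertex \<open>i\<close> and the limit graph \<open>h\<close> with root \<open>r\<close>.
  Finiteness is automatic when \<open>g\<close> has vertex set \<open>{1..n}\<close>. It is stated so that the event is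
  measurable on the space of all marked graphs: it is then a countable union over finite \<open>\<theta>\<close>.
\<close>

definition coupled ::
  "nat \<Rightarrow> real \<Rightarrow> 'v \<Rightarrow> (nat, 'a::polish_space mark) mgraph \<Rightarrow> nat \<Rightarrow> ('v, 'a mark) mgraph \<Rightarrow> bool" where
  "coupled k \<epsilon> r g i h \<longleftrightarrow> finite (in_verts g i k) \<and>
     (\<exists>\<theta>. mgraph_iso_on \<theta> h (in_verts h r k) g (in_verts g i k) \<and> \<theta> r = i \<and>
        (\<forall>v\<in>in_verts h r k. mark_dist (mark g (\<theta> v)) (mark h v) \<le> \<epsilon>))"


section \<open>Vertex-weighted directed random graphs\<close>

text \<open>
  The sigma-algebra generated by the attributes of the vertices \<open>1, ..., n\<close> of the random graph \<open>G\<close>.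
\<close>

definition attr_algebra ::
  "nat \<Rightarrow> 'w measure \<Rightarrow> ('w \<Rightarrow> (nat, 'a::polish_space mark) mgraph) \<Rightarrow> 'w measure" where
  "attr_algebra n M G = vimage_algebra (space M)
     (\<lambda>\<omega>. \<lambda>i\<in>{1..n}. mark_attr (mark (G \<omega>) i)) (PiM {1..n} (\<lambda>_. borel))"

definition vertex_weighted_digraph ::
  "real \<Rightarrow> nat \<Rightarrow> 'w measure \<Rightarrow> ('w \<Rightarrow> (nat, 'a::polish_space mark) mgraph) \<Rightarrow> bool" where
  "vertex_weighted_digraph c n M G \<longleftrightarrow>
     prob_space M \<and> G \<in> M \<rightarrow>\<^sub>M mgraph_algebra \<and>
     (\<forall>\<omega>\<in>space M. wf_mgraph (G \<omega>) \<and> verts (G \<omega>) = {1..n} \<and>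
        (\<forall>i\<in>{1..n}. valid_mark c (mark (G \<omega>) i) \<and>
           mark_deg (mark (G \<omega>) i) = (\<Sum>j\<in>{1..n}. edges (G \<omega>) j i))) \<and>
     cond_indep_vars M (attr_algebra n M G) borel (\<lambda>i \<omega>. mark_weight (mark (G \<omega>) i)) {1..n}"

definition graph_signals ::
  "real \<Rightarrow> real \<Rightarrow> ('a mark \<Rightarrow> real measure) \<Rightarrow> nat \<Rightarrow> 'w measure \<Rightarrow>
   ('w \<Rightarrow> (nat, 'a::polish_space mark) mgraph) \<Rightarrow> (nat \<Rightarrow> nat \<Rightarrow> 'w \<Rightarrow> real) \<Rightarrow> bool" where
  "graph_signals c d \<nu> n M G W \<longleftrightarrow>
     (let F = vimage_algebra (space M) G mgraph_algebra in
      cond_indep_vars M F borel (\<lambda>(i, k). W i k) ({1..n} \<times> UNIV) \<and>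
      (\<forall>i\<in>{1..n}. \<forall>k. has_cond_law M F borel (W i k) (\<lambda>\<omega>. \<nu> (mark (G \<omega>) i)) \<and>
         (\<forall>\<omega>\<in>space M. \<bar>W i k \<omega>\<bar> \<le> d + c - mark_weight_sum (mark (G \<omega>) i))))"


section \<open>Strong couplings\<close>

text \<open>
  \<open>\<Gamma> n\<close> is the law of the \<open>n\<close>th graph and \<open>\<Lambda>\<close> the law of the limit graph with root \<open>r\<close>.
  A coupling is a measure on the product space with prescribed marginals: the graph together
  with independent uniform vertices on one side, (independent) copies of the limit on the other.
\<close>

abbreviation uniform_vertex :: "nat \<Rightarrow> nat measure" where
  "uniform_vertex n \<equiv> measure_pmf (pmf_of_set {1..n})"

definition coupling1 ::
  "(nat, 'a::polish_space mark) mgraph measure \<Rightarrow> nat \<Rightarrow> ('v, 'a mark) mgraph measure \<Rightarrow>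
   ((nat, 'a mark) mgraph \<times> nat \<times> ('v, 'a mark) mgraph) measure \<Rightarrow> bool" where
  "coupling1 \<Gamma> n \<Lambda> \<pi> \<longleftrightarrow>
     sets \<pi> = sets (mgraph_algebra \<Otimes>\<^sub>M count_space UNIV \<Otimes>\<^sub>M mgraph_algebra) \<and>
     distr \<pi> (mgraph_algebra \<Otimes>\<^sub>M count_space UNIV) (\<lambda>(g, i, h). (g, i)) = \<Gamma> \<Otimes>\<^sub>M uniform_vertex n \<and>
     distr \<pi> mgraph_algebra (\<lambda>(g, i, h). h) = \<Lambda>"

definition coupling2 ::
  "(nat, 'a::polish_space mark) mgraph measure \<Rightarrow> nat \<Rightarrow> ('v, 'a mark) mgraph measure \<Rightarrow>
   ((nat, 'a mark) mgraph \<times> (nat \<times> nat) \<times> ('v, 'a mark) mgraph \<times> ('v, 'a mark) mgraph) measure \<Rightarrow> bool" where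
  "coupling2 \<Gamma> n \<Lambda> \<pi> \<longleftrightarrow>
     sets \<pi> = sets (mgraph_algebra \<Otimes>\<^sub>M (count_space UNIV \<Otimes>\<^sub>M count_space UNIV)
                     \<Otimes>\<^sub>M (mgraph_algebra \<Otimes>\<^sub>M mgraph_algebra)) \<and>
     distr \<pi> (mgraph_algebra \<Otimes>\<^sub>M (count_space UNIV \<Otimes>\<^sub>M count_space UNIV)) (\<lambda>(g, ij, hh). (g, ij))
       = \<Gamma> \<Otimes>\<^sub>M (uniform_vertex n \<Otimes>\<^sub>M uniform_vertex n) \<and>
     distr \<pi> (mgraph_algebra \<Otimes>\<^sub>M mgraph_algebra) (\<lambda>(g, ij, hh). hh) = \<Lambda> \<Otimes>\<^sub>M \<Lambda>"

definition strong_coupling ::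
  "(nat \<Rightarrow> (nat, 'a::polish_space mark) mgraph measure) \<Rightarrow>
   'v::countable \<Rightarrow> ('v, 'a mark) mgraph measure \<Rightarrow> bool" where
  "strong_coupling \<Gamma> r \<Lambda> \<longleftrightarrow>
     (\<forall>k\<ge>1. \<forall>\<epsilon>>0. \<exists>\<pi>. (\<forall>n\<ge>1. coupling1 (\<Gamma> n) n \<Lambda> (\<pi> n)) \<and>
        tendsto_in_prob \<pi>
          (\<lambda>n. prob_given (\<pi> n) (attr_algebra n (\<pi> n) fst) {(g, i, h). coupled k \<epsilon> r g i h}) 1) \<and>
     (\<forall>k\<ge>1. \<forall>\<epsilon>>0. \<exists>\<pi>. (\<forall>n\<ge>1. coupling2 (\<Gamma> n) n \<Lambda> (\<pi> n)) \<and>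
        tendsto_in_prob \<pi>
          (\<lambda>n. prob_given (\<pi> n) (attr_algebra n (\<pi> n) fst)
             {(g, (i, j), (h, h')). coupled k \<epsilon> r g i h \<and> coupled k \<epsilon> r g j h'}) 1)"


section \<open>Marked Galton-Watson trees\<close>

text \<open>
  Nodes are lists of child indices; \<open>i @ [j]\<close> is the \<open>(j+1)\<close>st child of \<open>i\<close>, and \<open>[0]\<close> is the
  first child of the root \<open>[]\<close>.
\<close>

definition gw_marks :: "real \<Rightarrow> 't measure \<Rightarrow> (nat list \<Rightarrow> 't \<Rightarrow> 'a::polish_space mark) \<Rightarrow> bool" where
  "gw_marks c P X \<longleftrightarrow>
     prob_space P \<and> (\<forall>i. X i \<in> P \<rightarrow>\<^sub>M mark_algebra) \<and>
     (\<forall>i. \<forall>t\<in>space P. valid_mark c (X i t)) \<and>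
     prob_space.indep_vars P (\<lambda>_. mark_algebra) X UNIV \<and>
     (\<forall>i j. i \<noteq> [] \<and> j \<noteq> [] \<longrightarrow> distr P mark_algebra (X i) = distr P mark_algebra (X j))"

inductive_set gw_nodes :: "(nat list \<Rightarrow> 'a mark) \<Rightarrow> nat list set" for x where
  root: "[] \<in> gw_nodes x"
| child: "i \<in> gw_nodes x \<Longrightarrow> j < mark_deg (x i) \<Longrightarrow> i @ [j] \<in> gw_nodes x"

definition gw_graph :: "(nat list \<Rightarrow> 'a mark) \<Rightarrow> (nat list, 'a mark) mgraph" where
  "gw_graph x = MGraph (gw_nodes x)
     (\<lambda>u v. of_bool (u \<in> gw_nodes x \<and> (\<exists>j. u = v @ [j])))
     (\<lambda>i. if i \<in> gw_nodes x then x i else undefined)"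

definition path_weight :: "(nat list \<Rightarrow> 'a mark) \<Rightarrow> nat list \<Rightarrow> real" where
  "path_weight x i = (\<Prod>m<length i. mark_weight (x (take m i)) (i ! m))"

lemma path_weight_Nil: "path_weight x [] = 1"
  by (simp add: path_weight_def)

lemma path_weight_snoc: "path_weight x (i @ [j]) = path_weight x i * mark_weight (x i) j"
  by (simp add: path_weight_def nth_append)

text \<open>Here \<open>x\<close> is a realization of the marks and \<open>w j s\<close> one of the signals.\<close>

definition limit_opinion ::
  "real \<Rightarrow> real \<Rightarrow> (nat list \<Rightarrow> 'a mark) \<Rightarrow> (nat list \<Rightarrow> nat \<Rightarrow> real) \<Rightarrow> real" where
  "limit_opinion c d x w =
     (\<Sum>s. \<Sum>l\<le>s. \<Sum>j\<in>{j \<in> gw_nodes x. length j = l}.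
        path_weight x j * real (s choose l) * (1 - c - d) ^ (s - l) * w j s)"

definition media_signal ::
  "real \<Rightarrow> real \<Rightarrow> (nat list \<Rightarrow> 't \<Rightarrow> 'a mark) \<Rightarrow> (nat list \<Rightarrow> nat \<Rightarrow> 't \<Rightarrow> real) \<Rightarrow>
   nat list \<Rightarrow> nat \<Rightarrow> 't \<Rightarrow> real" where
  "media_signal c d X Z i k t =
     d * Z i k t + mark_opinion (X i t) * (c - mark_weight_sum (X i t))"

text \<open>
  Conditionally on all marks, the \<open>Z i k\<close> are independent and the law of \<open>media_signal c d X Z i k\<close>
  is \<open>\<nu> (X i)\<close>. As the latter depends on \<open>X i\<close> only and not on \<open>k\<close>, and \<open>d > 0\<close>, the variables
  \<open>Z i 0, Z i 1, ...\<close> are conditionally i.i.d. given \<open>X i\<close>.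
\<close>

definition media_signals ::
  "real \<Rightarrow> real \<Rightarrow> ('a mark \<Rightarrow> real measure) \<Rightarrow> 't measure \<Rightarrow>
   (nat list \<Rightarrow> 't \<Rightarrow> 'a::polish_space mark) \<Rightarrow> (nat list \<Rightarrow> nat \<Rightarrow> 't \<Rightarrow> real) \<Rightarrow> bool" where
  "media_signals c d \<nu> P X Z \<longleftrightarrow>
     (let F = vimage_algebra (space P) (\<lambda>t i. X i t) (PiM UNIV (\<lambda>_. mark_algebra)) in
      (\<forall>i k. \<forall>t\<in>space P. Z i k t \<in> {-1..1}) \<and>
      cond_indep_vars P F borel (\<lambda>(i, k). Z i k) UNIV \<and>
      (\<forall>i k. has_cond_law P F borel (media_signal c d X Z i k) (\<lambda>t. \<nu> (X i t))))"

end

theory Submission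
  imports Defs
begin

text \<open>
  Almost surely every node has offspring, so the weights of the children of a node add up to \<open>c\<close>,
  the opinion term of the media signals vanishes, and with \<open>\<Pi>\<close> the path weights
  \[ R = d Z_\emptyset^{(0)} + c \mu + d S, \qquad
     S = \sum_{l \ge 1} \sum_{|j| = l} \Pi_j (Z_j^{(l)} - \mu), \qquad \mu = E[Z_1]. \]
  Given the root mark, the terms of \<open>S\<close> are centered and pairwise orthogonal, and orthogonal to
  \<open>Z_\<emptyset>\<close>: among two nodes, the mark of the one in the later generation is independent of the other
  mark and of both path weights. The second moment of the terms of \<open>S\<close> in generation \<open>l\<close> picks up a
  factor \<open>\<rho>\<^sub>2 \<le> c < 1\<close> from each generation to the next, which gives the geometric series
  \<open>1 / (1 - \<rho>\<^sub>2)\<close>. The random sums over nodes are limits of sums over finite deterministic sets of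
  labels, because path weights vanish off the tree; as the path weights of a generation
  add up to at most \<open>c ^ l\<close>, dominated convergence applies.
\<close>

section \<open>Bounded measurable functions and conditional laws\<close>

text \<open>The conditional mean and variance given the root mark are identified by testing against
  bounded functions \<open>H\<close> of that mark, so the computations are identities between
  ordinary expectations. For this the class \<open>bounded_measurable\<close> uses a pointwise bound
  and no measure: it pulls back along measurable maps, passes to larger sigma-algebras, and makes
  every integrand integrable. Two obstacles shape the preparation. Conditional laws and conditional
  independence are given only through events, with null sets depending on the event, and have to be
  extended to functions. Moreover the known conditional law is that of the full signal, not of
  \<open>Z\<close>; the conditional moments of \<open>Z\<close> are recovered from it as two
  functions \<open>m\<close> and \<open>q\<close> of the mark, and afterwards \<nu> is no longer
  mentioned. The signals are centered at the overall mean \<mu>, not at \<open>m (X j)\<close>. Thus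
  the fluctuation of \<open>m (X j)\<close> is part of Var(Z_1), and orthogonality has to use the
  independence of the marks on top of the conditional independence of the signals.\<close>

definition bounded_measurable :: "'a measure \<Rightarrow> ('a \<Rightarrow> real) set" where
  "bounded_measurable N = {f \<in> borel_measurable N. \<exists>b. \<forall>x\<in>space N. \<bar>f x\<bar> \<le> b}"

lemma bounded_measurableI:
  assumes "f \<in> borel_measurable N" "\<And>x. x \<in> space N \<Longrightarrow> \<bar>f x\<bar> \<le> b"
  shows "f \<in> bounded_measurable N"
  using assms by (auto simp: bounded_measurable_def)

lemma bounded_measurableD: "f \<in> bounded_measurable N \<Longrightarrow> f \<in> borel_measurable N"
  by (simp add: bounded_measurable_def)

lemma bounded_measurableE:
  assumes "f \<in> bounded_measurable N"
  obtains b where "0 \<le> b" "\<And>x. x \<in> space N \<Longrightarrow> \<bar>f x\<bar> \<le> b"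
proof -
  obtain b where b: "\<forall>x\<in>space N. \<bar>f x\<bar> \<le> b"
    using assms by (auto simp: bounded_measurable_def)
  show thesis
    by (rule that[of "max 0 b"]) (use b in \<open>auto simp: max.coboundedI2\<close>)
qed

lemma bounded_measurable_const [intro, simp]: "(\<lambda>x. a) \<in> bounded_measurable N"
  by (rule bounded_measurableI[of _ _ "\<bar>a\<bar>"]) auto

lemma bounded_measurable_indicator [intro]:
  "A \<in> sets N \<Longrightarrow> indicator A \<in> bounded_measurable N"
  by (rule bounded_measurableI[of _ _ 1]) (auto simp: indicator_def)

lemma bounded_measurable_add [intro]:
  assumes "f \<in> bounded_measurable N" "g \<in> bounded_measurable N"
  shows "(\<lambda>x. f x + g x) \<in> bounded_measurable N"
proof -
  from assms obtain a b where "\<And>x. x \<in> space N \<Longrightarrow> \<bar>f x\<bar> \<le> a" "\<And>x. x \<in> space N \<Longrightarrow> \<bar>g x\<bar> \<le> b"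
    by (metis bounded_measurableE)
  then show ?thesis
    using assms[THEN bounded_measurableD]
    by (intro bounded_measurableI[of _ _ "a + b"]) (auto intro: order_trans[OF abs_triangle_ineq] add_mono)
qed

lemma bounded_measurable_mult [intro]:
  assumes "f \<in> bounded_measurable N" "g \<in> bounded_measurable N"
  shows "(\<lambda>x. f x * g x) \<in> bounded_measurable N"
proof -
  from assms obtain a b where "0 \<le> a" "\<And>x. x \<in> space N \<Longrightarrow> \<bar>f x\<bar> \<le> a" "\<And>x. x \<in> space N \<Longrightarrow> \<bar>g x\<bar> \<le> b"
    by (metis bounded_measurableE)
  then show ?thesis
    using assms[THEN bounded_measurableD]
    by (intro bounded_measurableI[of _ _ "a * b"]) (auto simp: abs_mult intro!: mult_mono)
qed

lemma bounded_measurable_diff [intro]: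
  assumes "f \<in> bounded_measurable N" "g \<in> bounded_measurable N"
  shows "(\<lambda>x. f x - g x) \<in> bounded_measurable N"
  using bounded_measurable_add[OF assms(1) bounded_measurable_mult[OF bounded_measurable_const[of "-1"] assms(2)]]
  by simp

lemma bounded_measurable_power [intro]:
  "f \<in> bounded_measurable N \<Longrightarrow> (\<lambda>x. f x ^ n) \<in> bounded_measurable N"
  by (induction n) auto

lemma bounded_measurable_divide [intro]:
  "f \<in> bounded_measurable N \<Longrightarrow> (\<lambda>x. f x / a) \<in> bounded_measurable N"
  using bounded_measurable_mult[OF _ bounded_measurable_const[of "1 / a"], of f N] by simp

lemma bounded_measurable_sum [intro]:
  "(\<And>i. i \<in> I \<Longrightarrow> f i \<in> bounded_measurable N) \<Longrightarrow> (\<lambda>x. \<Sum>i\<in>I. f i x) \<in> bounded_measurable N"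
  by (induction I rule: infinite_finite_induct) auto

lemma bounded_measurable_compose [intro]:
  assumes "f \<in> bounded_measurable N" "X \<in> M \<rightarrow>\<^sub>M N"
  shows "(\<lambda>x. f (X x)) \<in> bounded_measurable M"
proof -
  from assms(1) obtain b where "\<And>x. x \<in> space N \<Longrightarrow> \<bar>f x\<bar> \<le> b"
    by (metis bounded_measurableE)
  then show ?thesis
    using measurable_space[OF assms(2)]
    by (intro bounded_measurableI[of _ _ b] measurable_compose[OF assms(2) bounded_measurableD[OF assms(1)]]) auto
qed

lemma bounded_measurable_subalgebra:
  assumes "f \<in> bounded_measurable F" "subalgebra M F"
  shows "f \<in> bounded_measurable M"
proof -
  from assms(1) obtain b where "\<And>x. x \<in> space F \<Longrightarrow> \<bar>f x\<bar> \<le> b"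
    by (metis bounded_measurableE)
  then show ?thesis
    using assms by (intro bounded_measurableI[of _ _ b] measurable_from_subalg[OF assms(2) bounded_measurableD])
      (auto simp: subalgebra_def dest: bounded_measurableD)
qed

context finite_measure
begin

lemma integrable_bounded_measurable [intro]:
  assumes "f \<in> bounded_measurable M"
  shows "integrable M f"
proof -
  from assms obtain b where "\<And>x. x \<in> space M \<Longrightarrow> \<bar>f x\<bar> \<le> b"
    by (metis bounded_measurableE)
  then show ?thesis
    by (intro integrable_const_bound[of _ b] bounded_measurableD[OF assms]) auto
qed

lemma integrable_bounded_mult:
  assumes "f \<in> bounded_measurable M" "integrable M g"
  shows "integrable M (\<lambda>x. f x * g x)"
proof -
  from assms(1) obtain b where b: "0 \<le> b" "\<And>x. x \<in> space M \<Longrightarrow> \<bar>f x\<bar> \<le> b"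
    by (metis bounded_measurableE)
  have [measurable]: "f \<in> borel_measurable M"
    using assms(1) by (rule bounded_measurableD)
  show ?thesis
  proof (rule Bochner_Integration.integrable_bound)
    show "integrable M (\<lambda>x. b * g x)"
      using assms(2) by simp
    show "AE x in M. norm (f x * g x) \<le> norm (b * g x)"
      using b by (auto simp: abs_mult intro!: mult_right_mono)
  qed (use assms(2) in measurable)
qed

lemma sigma_finite_subalgebraI:
  assumes "subalgebra M F"
  shows "sigma_finite_subalgebra M F"
  by (intro finite_measure_subalgebra_is_sigma_finite)
    (simp add: finite_measure_subalgebra_def finite_measure_subalgebra_axioms_def assms finite_measure_axioms)

lemma subalgebra_vimage_algebra:
  "X \<in> M \<rightarrow>\<^sub>M N \<Longrightarrow> subalgebra M (vimage_algebra (space M) X N)"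
  by (simp add: subalgebra_def sets_image_in_sets)

text \<open>The hypothesis says that the conditional expectation of \<open>w\<close> given \<open>Z\<close> vanishes.\<close>

lemma integral_mult_eq_0_of_indicator:
  assumes w: "integrable M w" and Z: "Z \<in> M \<rightarrow>\<^sub>M N"
    and f: "f \<in> bounded_measurable N"
    and zero: "\<And>B. B \<in> sets N \<Longrightarrow> (\<integral>x. w x * indicator B (Z x) \<partial>M) = 0"
  shows "(\<integral>x. w x * f (Z x) \<partial>M) = 0"
proof -
  let ?F = "vimage_algebra (space M) Z N"
  have sub: "subalgebra M ?F"
    using Z by (rule subalgebra_vimage_algebra)
  interpret F: sigma_finite_subalgebra M ?F
    using sub by (rule sigma_finite_subalgebraI)
  have ZF: "Z \<in> ?F \<rightarrow>\<^sub>M N"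
    using Z by (intro measurable_vimage_algebra1) (auto dest: measurable_space)
  have "AE x in M. real_cond_exp M ?F w x = 0"
  proof (rule F.real_cond_exp_charact[OF _ w])
    fix A assume "A \<in> sets ?F"
    then obtain B where B: "B \<in> sets N" "A = Z -` B \<inter> space M"
      using Z by (subst (asm) sets_vimage_algebra2) (auto dest: measurable_space)
    have "(\<integral>x\<in>A. w x \<partial>M) = (\<integral>x. w x * indicator B (Z x) \<partial>M)"
      unfolding set_lebesgue_integral_def
      by (intro Bochner_Integration.integral_cong) (auto simp: B indicator_def)
    then show "(\<integral>x\<in>A. w x \<partial>M) = (\<integral>x\<in>A. 0 \<partial>M)"
      using zero[OF B(1)] by simp
  qed auto
  moreover have [measurable]: "(\<lambda>x. f (Z x)) \<in> borel_measurable M"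
    using bounded_measurable_compose[OF f Z] by (rule bounded_measurableD)
  ultimately have "(\<integral>x. f (Z x) * real_cond_exp M ?F w x \<partial>M) = (\<integral>x. 0 \<partial>M)"
    by (intro integral_cong_AE) auto
  moreover have "(\<integral>x. f (Z x) * real_cond_exp M ?F w x \<partial>M) = (\<integral>x. f (Z x) * w x \<partial>M)"
    using w by (intro F.real_cond_exp_intg(2) integrable_bounded_mult bounded_measurable_compose[OF f Z]
        bounded_measurableD[OF bounded_measurable_compose[OF f ZF]]) auto
  ultimately show ?thesis
    by (simp add: mult.commute)
qed

end

section \<open>Conditional laws and conditional independence as integral identities\<close>

context prob_space
begin

text \<open>In \<open>has_cond_law\<close> the exceptional null set depends on the event, so it is
  not an identity of measures outcome by outcome. But on the restriction of \<open>M\<close> to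
  \<open>A\<close> the law of \<open>W\<close> and the mixture of the kernels agree on every event,
  hence are the same measure, and \<open>f\<close> is integrated against both.\<close>

lemma integral_cond_law:
  assumes law: "has_cond_law M F N W \<kappa>" and sub: "subalgebra M F"
    and \<kappa>: "\<kappa> \<in> F \<rightarrow>\<^sub>M prob_algebra N"
    and f: "f \<in> bounded_measurable N" and A: "A \<in> sets F"
  shows "(\<integral>x. indicator A x * f (W x) \<partial>M) = (\<integral>x. indicator A x * (\<integral>y. f y \<partial>\<kappa> x) \<partial>M)"
proof -
  interpret F: sigma_finite_subalgebra M F
    using sub by (rule sigma_finite_subalgebraI)
  have W [measurable]: "W \<in> M \<rightarrow>\<^sub>M N"
    and pg: "\<And>B. B \<in> sets N \<Longrightarrow> AE x in M. prob_given M F (W -` B \<inter> space M) x = measure (\<kappa> x) B"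
    using law by (auto simp: has_cond_law_def)
  have AM [measurable]: "A \<in> sets M"
    using A sub by (auto simp: subalgebra_def)
  have \<kappa>M [measurable]: "\<kappa> \<in> M \<rightarrow>\<^sub>M subprob_algebra N"
    using measurable_from_subalg[OF sub \<kappa>] by (rule measurable_prob_algebraD)
  have \<kappa>p: "prob_space (\<kappa> x)" "sets (\<kappa> x) = sets N" if "x \<in> space M" for x
    using measurable_space[OF \<kappa>, of x] that sub by (auto simp: space_prob_algebra subalgebra_def)
  \<comment> \<open>The restriction of \<open>M\<close> to \<open>A\<close>, kept on the whole space
    so that the kernel applies unchanged.\<close>
  let ?D = "density M (indicator A)"
  have \<kappa>D: "\<kappa> \<in> ?D \<rightarrow>\<^sub>M subprob_algebra N"
    by simp
  have ne: "space ?D \<noteq> {}"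
    using not_empty by simp
  have fin: "finite_measure ?D"
    by (intro finite_measureI) (simp add: emeasure_density)
  have fN [measurable]: "f \<in> borel_measurable N"
    using f by (rule bounded_measurableD)
  from f obtain b where b: "\<And>x. x \<in> space N \<Longrightarrow> \<bar>f x\<bar> \<le> b"
    by (metis bounded_measurableE)
  have eq: "distr ?D N W = ?D \<bind> \<kappa>"
  proof (rule measure_eqI)
    show "sets (distr ?D N W) = sets (?D \<bind> \<kappa>)"
      using sets_bind[OF sets_kernel[OF \<kappa>D] ne] by simp
    fix B assume "B \<in> sets (distr ?D N W)"
    then have B [measurable]: "B \<in> sets N" by simp
    let ?C = "W -` B \<inter> space M"
    have iC: "integrable M (indicator ?C :: _ \<Rightarrow> real)"
      by (intro integrable_bounded_measurable bounded_measurable_indicator) measurable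
    have "emeasure (distr ?D N W) B = emeasure M (A \<inter> ?C)"
      by (simp add: emeasure_distr emeasure_density flip: indicator_inter_arith)
    also have "\<dots> = ennreal (\<integral>x. indicator A x * indicator ?C x \<partial>M)"
      by (simp add: emeasure_eq_measure flip: indicator_inter_arith)
    also have "(\<integral>x. indicator A x * indicator ?C x \<partial>M) = (\<integral>x. indicator A x * prob_given M F ?C x \<partial>M)"
      unfolding prob_given_def using A iC
      by (intro F.real_cond_exp_intg(2)[symmetric] integrable_bounded_mult) auto
    also have "\<dots> = (\<integral>x. indicator A x * measure (\<kappa> x) B \<partial>M)"
    proof (rule integral_cong_AE)
      show "AE x in M. indicator A x * prob_given M F ?C x = indicator A x * measure (\<kappa> x) B"
        using pg[OF B] by eventually_elim simp
    qed (auto simp: prob_given_def)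
    also have "ennreal \<dots> = (\<integral>\<^sup>+x. ennreal (indicator A x * measure (\<kappa> x) B) \<partial>M)"
      by (intro nn_integral_eq_integral[symmetric] integrable_const_bound[of _ 1])
        (auto simp: indicator_def prob_space.prob_le_1[OF \<kappa>p(1)])
    also have "\<dots> = (\<integral>\<^sup>+x. indicator A x * emeasure (\<kappa> x) B \<partial>M)"
      by (intro nn_integral_cong)
        (auto simp: indicator_def finite_measure.emeasure_eq_measure[OF prob_space.finite_measure[OF \<kappa>p(1)]])
    also have "\<dots> = (\<integral>\<^sup>+x. emeasure (\<kappa> x) B \<partial>?D)"
      by (subst nn_integral_density) auto
    also have "\<dots> = emeasure (?D \<bind> \<kappa>) B"
      using emeasure_bind[OF ne \<kappa>D B] by simp
    finally show "emeasure (distr ?D N W) B = emeasure (?D \<bind> \<kappa>) B" .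
  qed
  have dens: "?D = density M (\<lambda>x. ennreal (indicator A x))"
    by (intro arg_cong[where f = "density M"]) (auto simp: fun_eq_iff indicator_def)
  have "(\<integral>x. indicator A x * f (W x) \<partial>M) = (\<integral>x. f (W x) \<partial>?D)"
    unfolding dens by (subst integral_density) auto
  also have "\<dots> = (\<integral>y. f y \<partial>(?D \<bind> \<kappa>))"
    unfolding eq[symmetric] by (subst integral_distr) auto
  also have "\<dots> = (\<integral>x. \<integral>y. f y \<partial>\<kappa> x \<partial>?D)"
    using b by (intro integral_bind[where K=N and B=b and B'=1] \<kappa>D fin)
      (auto simp: prob_space.emeasure_le_1[OF \<kappa>p(1)])
  also have "\<dots> = (\<integral>x. indicator A x * (\<integral>y. f y \<partial>\<kappa> x) \<partial>M)"
    unfolding dens by (subst integral_density)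
      (auto intro!: measurable_compose[OF \<kappa>M integral_measurable_subprob_algebra])
  finally show ?thesis .
qed

lemma real_cond_exp_cond_law:
  assumes law: "has_cond_law M F N W \<kappa>" and sub: "subalgebra M F"
    and \<kappa>: "\<kappa> \<in> F \<rightarrow>\<^sub>M prob_algebra N" and f: "f \<in> bounded_measurable N"
    and m: "(\<lambda>x. \<integral>y. f y \<partial>\<kappa> x) \<in> bounded_measurable F"
  shows "AE x in M. real_cond_exp M F (\<lambda>x. f (W x)) x = (\<integral>y. f y \<partial>\<kappa> x)"
proof -
  interpret F: sigma_finite_subalgebra M F
    using sub by (rule sigma_finite_subalgebraI)
  have W: "W \<in> M \<rightarrow>\<^sub>M N"
    using law by (simp add: has_cond_law_def)
  show ?thesis
    using integral_cond_law[OF law sub \<kappa> f] m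
    by (intro F.real_cond_exp_charact integrable_bounded_measurable bounded_measurable_compose[OF f W]
        bounded_measurable_subalgebra[OF m sub])
      (auto simp: set_lebesgue_integral_def dest: bounded_measurableD)
qed

lemma expectation_mult_cond_law:
  assumes law: "has_cond_law M F N W \<kappa>" and sub: "subalgebra M F"
    and \<kappa>: "\<kappa> \<in> F \<rightarrow>\<^sub>M prob_algebra N" and f: "f \<in> bounded_measurable N"
    and m: "(\<lambda>x. \<integral>y. f y \<partial>\<kappa> x) \<in> bounded_measurable F" and H: "H \<in> bounded_measurable F"
  shows "expectation (\<lambda>x. H x * f (W x)) = expectation (\<lambda>x. H x * (\<integral>y. f y \<partial>\<kappa> x))"
proof -
  interpret F: sigma_finite_subalgebra M F
    using sub by (rule sigma_finite_subalgebraI)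
  have W: "W \<in> M \<rightarrow>\<^sub>M N"
    using law by (simp add: has_cond_law_def)
  note fW = bounded_measurable_compose[OF f W]
  note HM = bounded_measurable_subalgebra[OF H sub]
  note [measurable] = bounded_measurableD[OF HM] bounded_measurableD[OF bounded_measurable_subalgebra[OF m sub]]
  have "expectation (\<lambda>x. H x * f (W x)) = expectation (\<lambda>x. H x * real_cond_exp M F (\<lambda>x. f (W x)) x)"
    by (intro F.real_cond_exp_intg(2)[symmetric] integrable_bounded_measurable bounded_measurable_mult HM fW
        bounded_measurableD[OF H] bounded_measurableD[OF fW])
  also have "\<dots> = expectation (\<lambda>x. H x * (\<integral>y. f y \<partial>\<kappa> x))"
    using real_cond_exp_cond_law[OF law sub \<kappa> f m] by (intro integral_cong_AE) auto
  finally show ?thesis .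
qed

text \<open>Conditional independence is given for events. It is extended one variable at a time:
  first to functions of \<open>X i\<close> against events of \<open>X j\<close>, then to functions
  of \<open>X j\<close>. Only \<open>f\<close> is replaced by its conditional expectation, which
  leaves \<open>g (X j)\<close> free for a later moment identity.\<close>

lemma integral_mult_cond_indep:
  assumes ind: "cond_indep_vars M F N X I" and sub: "subalgebra M F"
    and ij: "i \<in> I" "j \<in> I" "i \<noteq> j"
    and f: "f \<in> bounded_measurable N" and g: "g \<in> bounded_measurable N"
    and H: "H \<in> bounded_measurable F"
  shows "(\<integral>x. H x * (f (X i x) * g (X j x)) \<partial>M)
       = (\<integral>x. H x * (real_cond_exp M F (\<lambda>x. f (X i x)) x * g (X j x)) \<partial>M)"
proof -
  interpret F: sigma_finite_subalgebra M F
    using sub by (rule sigma_finite_subalgebraI)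
  have X: "X i \<in> M \<rightarrow>\<^sub>M N" "X j \<in> M \<rightarrow>\<^sub>M N"
    using ind ij by (auto simp: cond_indep_vars_def)
  let ?E = "\<lambda>u. real_cond_exp M F u"
  have HM: "H \<in> bounded_measurable M"
    using H sub by (rule bounded_measurable_subalgebra)
  have HF: "H \<in> borel_measurable F"
    using H by (rule bounded_measurableD)
  have fX: "(\<lambda>x. f (X i x)) \<in> bounded_measurable M" and gX: "(\<lambda>x. g (X j x)) \<in> bounded_measurable M"
    using f g X by auto
  have intE: "integrable M (?E u)" if "u \<in> bounded_measurable M" for u
    using that by (intro F.real_cond_exp_int integrable_bounded_measurable)
  have ind2: "AE x in M. ?E (\<lambda>x. indicator B (X i x) * indicator C (X j x)) x
      = ?E (\<lambda>x. indicator B (X i x)) x * ?E (\<lambda>x. indicator C (X j x)) x"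
    if B: "B \<in> sets N" and C: "C \<in> sets N" for B C
  proof -
    have "\<forall>J B. J \<subseteq> I \<and> finite J \<and> J \<noteq> {} \<and> (\<forall>j\<in>J. B j \<in> sets N) \<longrightarrow>
        (AE \<omega> in M. prob_given M F (\<Inter>j\<in>J. X j -` B j \<inter> space M) \<omega>
                  = (\<Prod>j\<in>J. prob_given M F (X j -` B j \<inter> space M) \<omega>))"
      using ind by (auto simp: cond_indep_vars_def)
    from this[rule_format, of "{i, j}" "\<lambda>k. if k = i then B else C"]
    have "AE x in M. prob_given M F ((X i -` B \<inter> space M) \<inter> (X j -` C \<inter> space M)) x
        = prob_given M F (X i -` B \<inter> space M) x * prob_given M F (X j -` C \<inter> space M) x"
      using ij B C by (simp add: Int_ac cong: if_cong)
    moreover have "AE x in M. ?E (indicator (X k -` D \<inter> space M)) x = ?E (\<lambda>x. indicator D (X k x)) x"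
      if "D \<in> sets N" "X k \<in> M \<rightarrow>\<^sub>M N" for D k
      using that by (intro F.real_cond_exp_cong) (auto simp: indicator_def measurable_sets)
    note this[OF B X(1)] this[OF C X(2)]
    moreover have "AE x in M. ?E (indicator ((X i -` B \<inter> space M) \<inter> (X j -` C \<inter> space M))) x
        = ?E (\<lambda>x. indicator B (X i x) * indicator C (X j x)) x"
      using B C X by (intro F.real_cond_exp_cong) (auto simp: indicator_def measurable_sets)
    ultimately show ?thesis
      unfolding prob_given_def by eventually_elim simp
  qed
  have step1: "(\<integral>x. H x * (f (X i x) * indicator C (X j x)) \<partial>M)
      = (\<integral>x. H x * (?E (\<lambda>x. f (X i x)) x * indicator C (X j x)) \<partial>M)" if C: "C \<in> sets N" for C
  proof -
    let ?C = "\<lambda>x. indicator C (X j x) :: real"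
    have CX: "?C \<in> bounded_measurable M"
      using bounded_measurable_compose[OF bounded_measurable_indicator[OF C] X(2)] .
    \<comment> \<open>An event of \<open>X j\<close> minus its conditional probability, weighted
      with \<open>H\<close>, integrates to zero over every event of \<open>X i\<close>, hence
      against \<open>f (X i)\<close>.\<close>
    have "(\<integral>x. (H x * (?C x - ?E ?C x)) * f (X i x) \<partial>M) = 0"
    proof (rule integral_mult_eq_0_of_indicator[OF _ X(1) f])
      show "integrable M (\<lambda>x. H x * (?C x - ?E ?C x))"
        using CX intE[OF CX] by (intro integrable_bounded_mult HM Bochner_Integration.integrable_diff) auto
      fix B assume B: "B \<in> sets N"
      let ?B = "\<lambda>x. indicator B (X i x) :: real"
      have BX: "?B \<in> bounded_measurable M"
        using bounded_measurable_compose[OF bounded_measurable_indicator[OF B] X(1)] .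
      have "(\<integral>x. H x * (?B x * ?C x) \<partial>M) = (\<integral>x. H x * ?E (\<lambda>x. ?B x * ?C x) x \<partial>M)"
        using BX CX by (intro F.real_cond_exp_intg(2)[symmetric] integrable_bounded_measurable HF)
          (auto intro: HM bounded_measurableD)
      also have "\<dots> = (\<integral>x. H x * (?E ?B x * ?E ?C x) \<partial>M)"
        using ind2[OF B C] HM[THEN bounded_measurableD]
        by (intro integral_cong_AE) (auto intro!: borel_measurable_times borel_measurable_cond_exp2)
      also have "\<dots> = (\<integral>x. (H x * ?E ?C x) * ?E ?B x \<partial>M)"
        by (simp add: ac_simps)
      also have "\<dots> = (\<integral>x. (H x * ?E ?C x) * ?B x \<partial>M)"
      proof (rule F.real_cond_exp_intg(2))
        have "integrable M (\<lambda>x. (H x * ?B x) * ?E ?C x)"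
          using BX HM by (intro integrable_bounded_mult intE[OF CX]) auto
        then show "integrable M (\<lambda>x. (H x * ?E ?C x) * ?B x)"
          by (simp add: ac_simps)
      qed (use HF BX in \<open>auto dest: bounded_measurableD\<close>)
      finally have *: "(\<integral>x. H x * (?B x * ?C x) \<partial>M) = (\<integral>x. (H x * ?E ?C x) * ?B x \<partial>M)" .
      have "(\<integral>x. (H x * (?C x - ?E ?C x)) * ?B x \<partial>M)
          = (\<integral>x. H x * (?B x * ?C x) - (H x * ?B x) * ?E ?C x \<partial>M)"
        by (simp add: algebra_simps)
      also have "\<dots> = (\<integral>x. H x * (?B x * ?C x) \<partial>M) - (\<integral>x. (H x * ?B x) * ?E ?C x \<partial>M)"
        using BX CX HM by (intro Bochner_Integration.integral_diff integrable_bounded_mult intE[OF CX]) auto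
      also have "\<dots> = 0"
        using * by (simp add: ac_simps)
      finally show "(\<integral>x. (H x * (?C x - ?E ?C x)) * ?B x \<partial>M) = 0" .
    qed
    moreover have "(\<integral>x. (H x * (?C x - ?E ?C x)) * f (X i x) \<partial>M)
        = (\<integral>x. H x * (f (X i x) * ?C x) - (H x * f (X i x)) * ?E ?C x \<partial>M)"
      by (simp add: algebra_simps)
    moreover have "\<dots> = (\<integral>x. H x * (f (X i x) * ?C x) \<partial>M) - (\<integral>x. (H x * f (X i x)) * ?E ?C x \<partial>M)"
      using fX CX HM by (intro Bochner_Integration.integral_diff integrable_bounded_mult intE[OF CX]) auto
    ultimately have "(\<integral>x. H x * (f (X i x) * ?C x) \<partial>M) = (\<integral>x. (H x * ?E ?C x) * f (X i x) \<partial>M)"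
      by (simp add: ac_simps)
    \<comment> \<open>Conditional expectation is self-adjoint: it moves from the indicator to
      \<open>f (X i)\<close> by way of the product of both conditional expectations.\<close>
    also have "\<dots> = (\<integral>x. (H x * ?E ?C x) * ?E (\<lambda>x. f (X i x)) x \<partial>M)"
    proof (rule F.real_cond_exp_intg(2)[symmetric])
      have "integrable M (\<lambda>x. (H x * f (X i x)) * ?E ?C x)"
        using fX HM by (intro integrable_bounded_mult intE[OF CX]) auto
      then show "integrable M (\<lambda>x. (H x * ?E ?C x) * f (X i x))"
        by (simp add: ac_simps)
    qed (use HF fX in \<open>auto dest: bounded_measurableD\<close>)
    also have "\<dots> = (\<integral>x. (H x * ?E (\<lambda>x. f (X i x)) x) * ?E ?C x \<partial>M)"
      by (simp add: ac_simps)
    also have "\<dots> = (\<integral>x. (H x * ?E (\<lambda>x. f (X i x)) x) * ?C x \<partial>M)"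
    proof (rule F.real_cond_exp_intg(2))
      have "integrable M (\<lambda>x. (H x * ?C x) * ?E (\<lambda>x. f (X i x)) x)"
        using CX HM by (intro integrable_bounded_mult intE[OF fX]) auto
      then show "integrable M (\<lambda>x. (H x * ?E (\<lambda>x. f (X i x)) x) * ?C x)"
        by (simp add: ac_simps)
    qed (use HF CX in \<open>auto dest: bounded_measurableD\<close>)
    finally show ?thesis
      by (simp add: ac_simps)
  qed
  let ?f = "\<lambda>x. f (X i x)"
  \<comment> \<open>The same argument with the roles exchanged; \<open>step1\<close> provides the
    case of events of \<open>X j\<close>.\<close>
  have "(\<integral>x. (H x * (?f x - ?E ?f x)) * g (X j x) \<partial>M) = 0"
  proof (rule integral_mult_eq_0_of_indicator[OF _ X(2) g])
    show "integrable M (\<lambda>x. H x * (?f x - ?E ?f x))"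
      using fX intE[OF fX] by (intro integrable_bounded_mult HM Bochner_Integration.integrable_diff) auto
    fix C assume C: "C \<in> sets N"
    let ?C = "\<lambda>x. indicator C (X j x) :: real"
    have CX: "?C \<in> bounded_measurable M"
      using bounded_measurable_compose[OF bounded_measurable_indicator[OF C] X(2)] .
    have "(\<integral>x. (H x * (?f x - ?E ?f x)) * ?C x \<partial>M)
        = (\<integral>x. H x * (?f x * ?C x) - (H x * ?C x) * ?E ?f x \<partial>M)"
      by (simp add: algebra_simps)
    also have "\<dots> = (\<integral>x. H x * (?f x * ?C x) \<partial>M) - (\<integral>x. (H x * ?C x) * ?E ?f x \<partial>M)"
      using fX CX HM by (intro Bochner_Integration.integral_diff integrable_bounded_mult intE[OF fX]) auto
    also have "\<dots> = 0"
      using step1[OF C] by (simp add: ac_simps)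
    finally show "(\<integral>x. (H x * (?f x - ?E ?f x)) * ?C x \<partial>M) = 0" .
  qed
  moreover have "(\<integral>x. (H x * (?f x - ?E ?f x)) * g (X j x) \<partial>M)
      = (\<integral>x. H x * (?f x * g (X j x)) - (H x * g (X j x)) * ?E ?f x \<partial>M)"
    by (simp add: algebra_simps)
  moreover have "\<dots> = (\<integral>x. H x * (?f x * g (X j x)) \<partial>M) - (\<integral>x. (H x * g (X j x)) * ?E ?f x \<partial>M)"
    using fX gX HM by (intro Bochner_Integration.integral_diff integrable_bounded_mult intE[OF fX]) auto
  ultimately show ?thesis
    by (simp add: ac_simps)
qed

text \<open>Uniqueness of conditional expectation in tested form. It reduces each conditional claim
  about the root to an expectation identity with an indicator as weight.\<close>

lemma real_cond_exp_bounded: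
  assumes F: "subalgebra M F" and f: "f \<in> bounded_measurable M" and g: "g \<in> bounded_measurable F"
    and eq: "\<And>A. A \<in> sets F \<Longrightarrow> expectation (\<lambda>t. indicator A t * f t) = expectation (\<lambda>t. indicator A t * g t)"
  shows "AE t in M. real_cond_exp M F f t = g t"
proof -
  interpret FF: sigma_finite_subalgebra M F
    by (rule sigma_finite_subalgebraI[OF F])
  show ?thesis
    using eq by (intro FF.real_cond_exp_charact integrable_bounded_measurable f
        bounded_measurable_subalgebra[OF g F] bounded_measurableD[OF g]) (simp add: set_lebesgue_integral_def)
qed

lemma tendsto_expectation:
  fixes f :: "nat \<Rightarrow> 'a \<Rightarrow> real"
  assumes f: "\<And>n. f n \<in> borel_measurable M" and b: "\<And>n t. t \<in> space M \<Longrightarrow> \<bar>f n t\<bar> \<le> b"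
    and lim: "\<And>t. t \<in> space M \<Longrightarrow> (\<lambda>n. f n t) \<longlonglongrightarrow> g t"
  shows "(\<lambda>n. expectation (f n)) \<longlonglongrightarrow> expectation g"
proof (rule integral_dominated_convergence[where w="\<lambda>_. b"])
  show "g \<in> borel_measurable M"
    by (rule borel_measurable_LIMSEQ_real[of M f g, OF lim f])
  show "AE t in M. (\<lambda>n. f n t) \<longlonglongrightarrow> g t"
    by (rule AE_I2[OF lim])
  show "AE t in M. norm (f n t) \<le> b" for n
    unfolding real_norm_def by (rule AE_I2[OF b])
qed (rule f, simp)

end

lemma bounded_measurable_kernel:
  assumes \<nu>: "\<nu> \<in> N \<rightarrow>\<^sub>M prob_algebra L" and f: "f \<in> bounded_measurable L"
  shows "(\<lambda>x. \<integral>y. f y \<partial>\<nu> x) \<in> bounded_measurable N"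
proof -
  from f obtain b where b: "0 \<le> b" "\<And>y. y \<in> space L \<Longrightarrow> \<bar>f y\<bar> \<le> b"
    by (metis bounded_measurableE)
  show ?thesis
  proof (rule bounded_measurableI)
    show "(\<lambda>x. \<integral>y. f y \<partial>\<nu> x) \<in> borel_measurable N"
      by (rule measurable_compose[OF measurable_prob_algebraD[OF \<nu>]
          integral_measurable_subprob_algebra[OF bounded_measurableD[OF f]]])
    show "\<bar>\<integral>y. f y \<partial>\<nu> x\<bar> \<le> b" if "x \<in> space N" for x
    proof -
      have sp: "space (\<nu> x) = space L"
        using measurable_space[OF \<nu> that] by (intro sets_eq_imp_space_eq) (simp add: space_prob_algebra)
      interpret K: prob_space "\<nu> x"
        using measurable_space[OF \<nu> that] by (simp add: space_prob_algebra)
      have "f \<in> borel_measurable (\<nu> x)"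
        using measurable_space[OF \<nu> that] bounded_measurableD[OF f]
        by (simp add: space_prob_algebra cong: measurable_cong_sets)
      then have int: "integrable (\<nu> x) f"
        by (intro K.integrable_const_bound[of _ b]) (auto simp: b sp)
      have "\<bar>\<integral>y. f y \<partial>\<nu> x\<bar> \<le> (\<integral>y. \<bar>f y\<bar> \<partial>\<nu> x)"
        by (rule integral_abs_bound)
      also have "\<dots> \<le> (\<integral>y. b \<partial>\<nu> x)"
        using int b by (intro integral_mono) (auto simp: sp)
      finally show ?thesis
        by (simp add: K.prob_space)
    qed
  qed
qed

section \<open>Path weights\<close>

definition gw_layer :: "(nat list \<Rightarrow> 'a mark) \<Rightarrow> nat \<Rightarrow> nat list set" where
  "gw_layer x l = {j \<in> gw_nodes x. length j = l}"

text \<open>A deterministic finite substitute for the random generation \<open>gw_layer x l\<close>: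
  sums over it can be exchanged with expectations, and \<open>n\<close> tends to infinity only
  afterwards.\<close>

definition words :: "nat \<Rightarrow> nat \<Rightarrow> nat list set" where
  "words l n = {j. set j \<subseteq> {..<n} \<and> length j = l}"

lemma finite_words [simp]: "finite (words l n)"
  unfolding words_def by (rule finite_lists_length_eq) simp

lemma words_Suc: "words (Suc l) n = (\<lambda>(j, r). j @ [r]) ` (words l n \<times> {..<n})"
proof safe
  fix j assume "j \<in> words (Suc l) n"
  then show "j \<in> (\<lambda>(j, r). j @ [r]) ` (words l n \<times> {..<n})"
    by (cases j rule: rev_cases) (auto simp: words_def)
qed (auto simp: words_def)

lemma inj_snoc: "inj_on (\<lambda>(j, r). j @ [r]) A"
  by (auto simp: inj_on_def)

lemma sum_words_Suc: "(\<Sum>j\<in>words (Suc l) n. f j) = (\<Sum>j\<in>words l n. \<Sum>r<n. f (j @ [r]))"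
  unfolding words_Suc by (subst sum.reindex[OF inj_snoc]) (simp add: sum.cartesian_product case_prod_beta')

lemma Nil_in_gw_nodes: "[] \<in> gw_nodes x"
  by (rule gw_nodes.root)

lemma snoc_in_gw_nodes_iff: "j @ [r] \<in> gw_nodes x \<longleftrightarrow> j \<in> gw_nodes x \<and> r < mark_deg (x j)"
  by (auto intro: gw_nodes.child elim: gw_nodes.cases)

lemma gw_layer_0: "gw_layer x 0 = {[]}"
  by (auto simp: gw_layer_def Nil_in_gw_nodes)

lemma gw_layer_Suc:
  "gw_layer x (Suc l) = (\<lambda>(j, r). j @ [r]) ` (SIGMA j:gw_layer x l. {..<mark_deg (x j)})"
proof safe
  fix j assume "j \<in> gw_layer x (Suc l)"
  then show "j \<in> (\<lambda>(j, r). j @ [r]) ` (SIGMA j:gw_layer x l. {..<mark_deg (x j)})"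
    by (cases j rule: rev_cases) (auto simp: gw_layer_def snoc_in_gw_nodes_iff)
qed (auto simp: gw_layer_def snoc_in_gw_nodes_iff)

lemma finite_gw_layer [simp]: "finite (gw_layer x l)"
  by (induction l) (auto simp: gw_layer_0 gw_layer_Suc)

lemma sum_gw_layer_Suc:
  "(\<Sum>j\<in>gw_layer x (Suc l). f j) = (\<Sum>j\<in>gw_layer x l. \<Sum>r<mark_deg (x j). f (j @ [r]))"
  unfolding gw_layer_Suc
  by (subst sum.reindex[OF inj_snoc]) (simp add: sum.Sigma case_prod_beta')

text \<open>The sequence is eventually constant: a generation is finite, so all its labels have
  entries below some \<open>N\<close>, and the remaining words lie off the tree.\<close>

lemma sum_words_tendsto:
  fixes f :: "nat list \<Rightarrow> real"
  assumes "\<And>j. j \<notin> gw_nodes x \<Longrightarrow> f j = 0"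
  shows "(\<lambda>n. \<Sum>j\<in>words l n. f j) \<longlonglongrightarrow> (\<Sum>j\<in>gw_layer x l. f j)"
proof -
  have "finite (\<Union>j\<in>gw_layer x l. set j)"
    by auto
  then obtain N where N: "\<And>k. k \<in> (\<Union>j\<in>gw_layer x l. set j) \<Longrightarrow> k < N"
    unfolding finite_nat_set_iff_bounded by blast
  have "(\<Sum>j\<in>words l n. f j) = (\<Sum>j\<in>gw_layer x l. f j)" if "n \<ge> N" for n
  proof (rule sum.mono_neutral_right)
    show "gw_layer x l \<subseteq> words l n"
      using N that by (fastforce simp: words_def gw_layer_def)
    show "\<forall>j\<in>words l n - gw_layer x l. f j = 0"
      using assms by (auto simp: words_def gw_layer_def)
  qed simp
  then show ?thesis
    by (intro tendsto_eventually eventually_sequentiallyI[of N])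
qed

lemma valid_markD:
  assumes "valid_mark c x"
  shows "0 \<le> mark_weight x r" "mark_weight x r \<le> 1" "r \<ge> mark_deg x \<Longrightarrow> mark_weight x r = 0"
    "x \<in> mark_space" "0 < mark_deg x \<Longrightarrow> mark_weight_sum x = c"
  using assms by (cases x; auto simp: valid_mark_def mark_space_def)+

text \<open>Weights are nonnegative and vanish past the degree, so a partial sum is at most the
  total, which is \<open>c\<close>, or 0 for a node without children.\<close>

lemma valid_mark_sum_le:
  assumes "valid_mark c x" "0 \<le> c"
  shows "(\<Sum>r<n. mark_weight x r) \<le> c"
proof -
  have "(\<Sum>r<n. mark_weight x r) \<le> (\<Sum>r<max n (mark_deg x). mark_weight x r)"
    using valid_markD(1)[OF assms(1)] by (intro sum_mono2) auto
  also have "\<dots> = mark_weight_sum x"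
    unfolding mark_weight_sum_def using valid_markD(3)[OF assms(1)]
    by (intro sum.mono_neutral_right) auto
  also have "\<dots> \<le> c"
    using valid_markD(5)[OF assms(1)] assms(2) by (cases "mark_deg x > 0") (auto simp: mark_weight_sum_def)
  finally show ?thesis .
qed

text \<open>A single realization of the marks, valid at every label on or off the tree. The
  estimates made here are pathwise.\<close>

locale valid_tree =
  fixes c :: real and x :: "nat list \<Rightarrow> 'a mark"
  assumes valid: "\<And>i. valid_mark c (x i)" and c: "0 \<le> c" "c < 1"
begin

lemma path_weight_nonneg: "0 \<le> path_weight x j"
  unfolding path_weight_def using valid_markD[OF valid] by (intro prod_nonneg) auto

lemma path_weight_le_1: "path_weight x j \<le> 1"
  unfolding path_weight_def using valid_markD[OF valid] by (intro prod_le_1) auto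

text \<open>A path that leaves the tree uses at some step a child index beyond the degree, where a
  valid mark has weight zero.\<close>

lemma path_weight_eq_0: "j \<notin> gw_nodes x \<Longrightarrow> path_weight x j = 0"
proof (induction j rule: rev_induct)
  case Nil
  then show ?case by (simp add: Nil_in_gw_nodes)
next
  case (snoc r j)
  then show ?case
    using valid_markD(3)[OF valid, of j r] by (auto simp: snoc_in_gw_nodes_iff path_weight_snoc not_less)
qed

lemma sum_words_path_weight_le: "(\<Sum>j\<in>words l n. path_weight x j) \<le> c ^ l"
proof (induction l)
  case 0
  have "words 0 n = {[]}"
    by (auto simp: words_def)
  then show ?case by (simp add: path_weight_Nil)
next
  case (Suc l)
  have "(\<Sum>j\<in>words (Suc l) n. path_weight x j) = (\<Sum>j\<in>words l n. path_weight x j * (\<Sum>r<n. mark_weight (x j) r))"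
    by (simp add: sum_words_Suc path_weight_snoc sum_distrib_left)
  also have "\<dots> \<le> (\<Sum>j\<in>words l n. path_weight x j * c)"
    by (intro sum_mono mult_left_mono valid_mark_sum_le valid path_weight_nonneg c)
  also have "\<dots> \<le> c ^ l * c"
    unfolding sum_distrib_right[symmetric] using c by (intro mult_right_mono Suc) auto
  finally show ?case by (simp add: mult.commute)
qed

text \<open>The hypothesis ranges over all labels, including those off the tree. As there are
  countably many, it holds almost surely for all of them at once, see
  \<open>AE_mark_deg_pos\<close>.\<close>

lemma sum_gw_layer_path_weight:
  assumes "\<And>j. mark_deg (x j) > 0"
  shows "(\<Sum>j\<in>gw_layer x l. path_weight x j) = c ^ l"
proof (induction l)
  case 0
  then show ?case by (simp add: gw_layer_0 path_weight_Nil)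
next
  case (Suc l)
  have "(\<Sum>j\<in>gw_layer x (Suc l). path_weight x j) = (\<Sum>j\<in>gw_layer x l. path_weight x j * mark_weight_sum (x j))"
    by (simp add: sum_gw_layer_Suc path_weight_snoc sum_distrib_left mark_weight_sum_def)
  also have "\<dots> = c ^ Suc l"
    using Suc valid_markD(5)[OF valid assms] by (simp flip: sum_distrib_right)
  finally show ?case .
qed

lemma abs_sum_words_le:
  assumes y: "\<And>j. \<bar>y j\<bar> \<le> b"
  shows "\<bar>\<Sum>j\<in>words l n. path_weight x j * y j\<bar> \<le> b * c ^ l"
proof -
  have b: "0 \<le> b"
    using y[of "[]"] by linarith
  have "\<bar>\<Sum>j\<in>words l n. path_weight x j * y j\<bar> \<le> (\<Sum>j\<in>words l n. path_weight x j * b)"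
    by (intro order_trans[OF sum_abs] sum_mono) (auto simp: abs_mult path_weight_nonneg intro!: mult_left_mono y)
  also have "\<dots> \<le> c ^ l * b"
    unfolding sum_distrib_right[symmetric] by (intro mult_right_mono sum_words_path_weight_le b)
  finally show ?thesis by (simp add: mult.commute)
qed

lemma sum_words_path_weight_tendsto:
  "(\<lambda>n. \<Sum>j\<in>words l n. path_weight x j * y j) \<longlonglongrightarrow> (\<Sum>j\<in>gw_layer x l. path_weight x j * y j)"
  by (rule sum_words_tendsto) (simp add: path_weight_eq_0)

lemma abs_sum_gw_layer_le:
  assumes "\<And>j. \<bar>y j\<bar> \<le> b"
  shows "\<bar>\<Sum>j\<in>gw_layer x l. path_weight x j * y j\<bar> \<le> b * c ^ l"
  by (rule LIMSEQ_le_const2[OF tendsto_rabs[OF sum_words_path_weight_tendsto]])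
    (use abs_sum_words_le[OF assms] in auto)

lemma summable_gw_layer:
  assumes "\<And>j. \<bar>y j\<bar> \<le> b"
  shows "summable (\<lambda>l. \<Sum>j\<in>gw_layer x l. path_weight x j * y j)"
  by (rule summable_comparison_test'[where N=0 and g="\<lambda>l. b * c ^ l"])
    (use abs_sum_gw_layer_le[OF assms] c in \<open>auto intro!: summable_mult summable_geometric\<close>)

end

text \<open>One parameter bounds both the depth and the child indices, so that a single limit
  exhausts all nonroot labels.\<close>

definition nonroot_words :: "nat \<Rightarrow> nat list set" where
  "nonroot_words n = (\<Union>l<n. words (Suc l) n)"

lemma finite_nonroot_words [simp]: "finite (nonroot_words n)"
  by (simp add: nonroot_words_def)

lemma Nil_notin_nonroot_words: "j \<in> nonroot_words n \<Longrightarrow> j \<noteq> []"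
  by (auto simp: nonroot_words_def words_def)

lemma sum_nonroot_words: "(\<Sum>j\<in>nonroot_words n. f j) = (\<Sum>l<n. \<Sum>j\<in>words (Suc l) n. f j)"
  unfolding nonroot_words_def by (rule sum.UNION_disjoint) (simp, simp, auto simp: words_def)

context valid_tree
begin

text \<open>Each generation converges as the width grows, and generation \<open>Suc l\<close> is
  bounded by \<open>b * c ^ Suc l\<close> uniformly in \<open>n\<close>; Tannery's theorem lets
  depth and width grow together.\<close>

lemma sum_nonroot_words_tendsto:
  assumes y: "\<And>j. \<bar>y j\<bar> \<le> b"
  shows "(\<lambda>n. \<Sum>j\<in>nonroot_words n. path_weight x j * y j)
    \<longlonglongrightarrow> (\<Sum>l. \<Sum>j\<in>gw_layer x (Suc l). path_weight x j * y j)"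
proof -
  \<comment> \<open>The value 0 for generations not yet reached turns the finite sums into series
    over all \<open>l\<close>, as Tannery's theorem requires.\<close>
  define a where "a l n = (if l < n then \<Sum>j\<in>words (Suc l) n. path_weight x j * y j else 0)" for l n
  have "(\<lambda>n. \<Sum>l. a l n) \<longlonglongrightarrow> (\<Sum>l. \<Sum>j\<in>gw_layer x (Suc l). path_weight x j * y j)"
  proof (rule tannerys_theorem[THEN conjunct2, THEN conjunct2])
    show "(\<lambda>n. a l n) \<longlonglongrightarrow> (\<Sum>j\<in>gw_layer x (Suc l). path_weight x j * y j)" for l
    proof (rule Lim_transform_eventually[OF sum_words_path_weight_tendsto])
      show "\<forall>\<^sub>F n in sequentially. (\<Sum>j\<in>words (Suc l) n. path_weight x j * y j) = a l n"
        by (rule eventually_sequentiallyI[of "Suc l"]) (simp add: a_def)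
    qed
    have b: "0 \<le> b"
      using y[of "[]"] by linarith
    show "\<forall>\<^sub>F (l, n) in at_top \<times>\<^sub>F sequentially. norm (a l n) \<le> b * c ^ Suc l"
      using abs_sum_words_le[OF y] c b by (intro always_eventually) (auto simp: a_def simp del: power_Suc)
    show "summable (\<lambda>l. b * c ^ Suc l)"
      using c by (intro summable_mult) (simp add: summable_geometric summable_mult)
  qed simp
  moreover have "(\<Sum>l. a l n) = (\<Sum>j\<in>nonroot_words n. path_weight x j * y j)" for n
    unfolding sum_nonroot_words by (subst suminf_finite[of "{..<n}"]) (auto simp: a_def)
  ultimately show ?thesis by simp
qed

text \<open>The bound is free of \<open>n\<close>; it is the dominating constant when the limit is
  taken under expectations.\<close>

lemma abs_sum_nonroot_words_le:
  assumes y: "\<And>j. \<bar>y j\<bar> \<le> b"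
  shows "\<bar>\<Sum>j\<in>nonroot_words n. path_weight x j * y j\<bar> \<le> b / (1 - c)"
proof -
  have b: "0 \<le> b"
    using y[of "[]"] by linarith
  have "\<bar>\<Sum>j\<in>nonroot_words n. path_weight x j * y j\<bar> \<le> (\<Sum>l<n. b * c ^ Suc l)"
    unfolding sum_nonroot_words by (intro order_trans[OF sum_abs] sum_mono abs_sum_words_le y)
  also have "\<dots> \<le> (\<Sum>l<n. b * c ^ l)"
    using b c by (intro sum_mono mult_left_mono) (auto intro: mult_left_le_one_le)
  also have "\<dots> \<le> (\<Sum>l. b * c ^ l)"
    using b c by (intro sum_le_suminf summable_mult summable_geometric) auto
  also have "\<dots> = b / (1 - c)"
    using c by (simp add: suminf_mult suminf_geometric)
  finally show ?thesis .
qed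

end

section \<open>Marks of a Galton-Watson tree\<close>

lemma borel_measurable_mark_algebraI:
  "f \<in> borel_measurable borel \<Longrightarrow> f \<in> borel_measurable mark_algebra"
  unfolding mark_algebra_def by (rule measurable_restrict_space1)

lemma measurable_mark_weight [measurable]:
  "(\<lambda>x :: 'a::polish_space mark. mark_weight x r) \<in> borel_measurable mark_algebra"
proof -
  have eq: "(\<lambda>x :: 'a mark. mark_weight x r) = (\<lambda>x. snd (snd (snd (snd x))) r)"
    by auto
  have "continuous_on UNIV (\<lambda>x :: 'a mark. snd (snd (snd (snd x))))"
    by (intro continuous_intros)
  then have "continuous_on UNIV (\<lambda>x :: 'a mark. snd (snd (snd (snd x))) r)"
    by (rule continuous_on_product_then_coordinatewise)
  then show ?thesis
    unfolding eq by (intro borel_measurable_mark_algebraI borel_measurable_continuous_onI)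
qed

lemma measurable_mark_opinion [measurable]:
  "(mark_opinion :: 'a::polish_space mark \<Rightarrow> real) \<in> borel_measurable mark_algebra"
proof -
  have eq: "(mark_opinion :: 'a mark \<Rightarrow> real) = (\<lambda>x. fst (snd x))"
    by auto
  show ?thesis
    unfolding eq
    by (intro borel_measurable_mark_algebraI borel_measurable_continuous_onI continuous_intros)
qed

lemma measurable_mark_deg [measurable]:
  "(mark_deg :: 'a::polish_space mark \<Rightarrow> nat) \<in> mark_algebra \<rightarrow>\<^sub>M count_space UNIV"
proof -
  have eq: "(mark_deg :: 'a mark \<Rightarrow> nat) = (\<lambda>x. fst (snd (snd (snd x))))"
    by auto
  have "(mark_deg :: 'a mark \<Rightarrow> nat) \<in> borel \<rightarrow>\<^sub>M borel"
    unfolding eq by (intro borel_measurable_continuous_onI continuous_intros)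
  then have "(mark_deg :: 'a mark \<Rightarrow> nat) \<in> borel \<rightarrow>\<^sub>M count_space UNIV"
    by (simp add: measurable_cong_sets[OF refl sets_borel_eq_count_space])
  then show ?thesis
    unfolding mark_algebra_def by (rule measurable_restrict_space1)
qed

text \<open>The random number of summands is handled by splitting into the countably many values of
  the degree.\<close>

lemma measurable_sum_lessThan_mark_deg:
  assumes [measurable]: "\<And>r. f r \<in> borel_measurable mark_algebra"
  shows "(\<lambda>x :: 'a::polish_space mark. \<Sum>r<mark_deg x. f r x :: real) \<in> borel_measurable mark_algebra"
  by (rule measurable_compose_countable[where f="\<lambda>n x. \<Sum>r<n. f r x" and g=mark_deg]) auto

lemma measurable_mark_weight_sum [measurable]:
  "(mark_weight_sum :: 'a::polish_space mark \<Rightarrow> real) \<in> borel_measurable mark_algebra"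
  unfolding mark_weight_sum_def[abs_def] by (rule measurable_sum_lessThan_mark_deg) measurable

lemma space_mark_algebra: "space mark_algebra = mark_space"
  by (simp add: mark_algebra_def space_restrict_space)

lemma bounded_measurable_mark_weight [intro]:
  "(\<lambda>x :: 'a::polish_space mark. mark_weight x r) \<in> bounded_measurable mark_algebra"
  by (rule bounded_measurableI[of _ _ 1]) (auto simp: space_mark_algebra mark_space_def)

section \<open>Independence and equal laws of the marks\<close>

locale gw_tree = prob_space P for P :: "'t measure" +
  fixes c :: real and X :: "nat list \<Rightarrow> 't \<Rightarrow> 'a::polish_space mark"
  assumes gw: "gw_marks c P X" and c: "0 \<le> c" "c < 1"
begin

text \<open>The index set \<open>J\<close> records which marks a function may read. The cases that
  carry the proof are \<open>{[]}\<close> for test functions, \<open>- {j}\<close> for factors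
  independent of the mark of \<open>j\<close>, and \<open>UNIV\<close> for conditioning on all
  marks.\<close>

definition marks_algebra :: "nat list set \<Rightarrow> 't measure" where
  "marks_algebra J = vimage_algebra (space P) (\<lambda>t. \<lambda>i\<in>J. X i t) (PiM J (\<lambda>_. mark_algebra))"

abbreviation pw :: "nat list \<Rightarrow> 't \<Rightarrow> real" where
  "pw j t \<equiv> path_weight (\<lambda>i. X i t) j"

lemma X_measurable [measurable]: "X i \<in> P \<rightarrow>\<^sub>M mark_algebra"
  using gw by (simp add: gw_marks_def)

lemma valid_mark_X: "t \<in> space P \<Longrightarrow> valid_mark c (X i t)"
  using gw by (simp add: gw_marks_def)

lemma valid_tree_X: "t \<in> space P \<Longrightarrow> valid_tree c (\<lambda>i. X i t)"
  by (unfold_locales) (auto simp: valid_mark_X c)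

lemma restrict_X_measurable: "(\<lambda>t. \<lambda>i\<in>J. X i t) \<in> P \<rightarrow>\<^sub>M PiM J (\<lambda>_. mark_algebra)"
  by (intro measurable_restrict) simp

lemma subalgebra_marks_algebra: "subalgebra P (marks_algebra J)"
  unfolding marks_algebra_def by (intro subalgebra_vimage_algebra restrict_X_measurable)

lemma space_marks_algebra [simp]: "space (marks_algebra J) = space P"
  by (simp add: marks_algebra_def)

lemma X_measurable_marks_algebra:
  assumes "i \<in> J"
  shows "X i \<in> marks_algebra J \<rightarrow>\<^sub>M mark_algebra"
proof -
  have "(\<lambda>t. \<lambda>i\<in>J. X i t) \<in> marks_algebra J \<rightarrow>\<^sub>M PiM J (\<lambda>_. mark_algebra)"
    unfolding marks_algebra_def
    by (intro measurable_vimage_algebra1 funcsetI measurable_space[OF restrict_X_measurable])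
  from measurable_compose[OF this measurable_component_singleton[OF assms]] show ?thesis
    using assms by simp
qed

lemma subalgebra_marks_algebra_mono:
  assumes "J \<subseteq> K"
  shows "subalgebra (marks_algebra K) (marks_algebra J)"
  unfolding subalgebra_def
proof
  show "sets (marks_algebra J) \<subseteq> sets (marks_algebra K)"
    unfolding marks_algebra_def[of J] using assms
    by (intro sets_image_in_sets measurable_restrict X_measurable_marks_algebra) auto
qed simp

lemma marks_algebra_mono:
  "f \<in> bounded_measurable (marks_algebra J) \<Longrightarrow> J \<subseteq> K \<Longrightarrow> f \<in> bounded_measurable (marks_algebra K)"
  by (rule bounded_measurable_subalgebra[OF _ subalgebra_marks_algebra_mono])

lemma marks_algebra_P: "f \<in> bounded_measurable (marks_algebra J) \<Longrightarrow> f \<in> bounded_measurable P"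
  by (rule bounded_measurable_subalgebra[OF _ subalgebra_marks_algebra])

lemma mark_function_in_marks_algebra:
  "g \<in> bounded_measurable mark_algebra \<Longrightarrow> i \<in> J \<Longrightarrow> (\<lambda>t. g (X i t)) \<in> bounded_measurable (marks_algebra J)"
  by (rule bounded_measurable_compose[OF _ X_measurable_marks_algebra])

text \<open>The weight of an edge is stored in the mark of its parent, so the path weight of
  \<open>j\<close> reads the marks of the proper prefixes of \<open>j\<close> and not the mark of
  \<open>j\<close> itself. All later independence arguments rest on this.\<close>

lemma path_weight_in_marks_algebra:
  assumes "\<And>m. m < length j \<Longrightarrow> take m j \<in> J"
  shows "pw j \<in> bounded_measurable (marks_algebra J)"
proof (rule bounded_measurableI[of _ _ 1])
  show "pw j \<in> borel_measurable (marks_algebra J)"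
    unfolding path_weight_def
    using measurable_compose[OF X_measurable_marks_algebra measurable_mark_weight] assms
    by (intro borel_measurable_prod) auto
  show "\<bar>pw j t\<bar> \<le> 1" if "t \<in> space (marks_algebra J)" for t
    using valid_tree.path_weight_nonneg[OF valid_tree_X] valid_tree.path_weight_le_1[OF valid_tree_X] that by simp
qed

lemma indep_var_marks_algebra:
  assumes H: "H1 \<in> borel_measurable (marks_algebra J1)" "H2 \<in> borel_measurable (marks_algebra J2)"
    and disj: "J1 \<inter> J2 = {}"
  shows "indep_var borel H1 borel (H2 :: 't \<Rightarrow> real)"
proof -
  \<comment> \<open>The two blocks form a family indexed by \<open>bool\<close>, so that grouping of
    an independent family over disjoint blocks applies.\<close>
  let ?K = "case_bool J1 J2"
  have "indep_vars (\<lambda>_. mark_algebra) X UNIV"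
    using gw by (simp add: gw_marks_def)
  then have "indep_vars (\<lambda>b. PiM (?K b) (\<lambda>_. mark_algebra)) (\<lambda>b t. restrict (\<lambda>i. X i t) (?K b)) UNIV"
    by (rule indep_vars_restrict) (use disj in \<open>auto simp: disjoint_family_on_def split: bool.splits\<close>)
  then have ind: "indep_sets (\<lambda>b. {(\<lambda>t. restrict (\<lambda>i. X i t) (?K b)) -` A \<inter> space P |A.
      A \<in> sets (PiM (?K b) (\<lambda>_. mark_algebra))}) UNIV"
    by (simp add: indep_vars_def2)
  have eq: "{(\<lambda>t. restrict (\<lambda>i. X i t) (?K b)) -` A \<inter> space P |A. A \<in> sets (PiM (?K b) (\<lambda>_. mark_algebra))}
      = sets (marks_algebra (?K b))" for b
    unfolding marks_algebra_def
    by (intro sets_vimage_algebra2[symmetric] funcsetI measurable_space[OF restrict_X_measurable])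
  have "indep_sets (\<lambda>b. {case_bool H1 H2 b -` A \<inter> space P |A. A \<in> sets (case_bool borel borel b)}) UNIV"
  proof (rule indep_sets_mono_sets[OF ind])
    fix b
    show "{case_bool H1 H2 b -` A \<inter> space P |A. A \<in> sets (case_bool borel borel b)}
      \<subseteq> {(\<lambda>t. restrict (\<lambda>i. X i t) (?K b)) -` A \<inter> space P |A. A \<in> sets (PiM (?K b) (\<lambda>_. mark_algebra))}"
      unfolding eq using H[THEN measurable_sets] by (cases b) auto
  qed
  moreover have "H1 \<in> borel_measurable P" "H2 \<in> borel_measurable P"
    using H measurable_from_subalg[OF subalgebra_marks_algebra] by auto
  ultimately show ?thesis
    unfolding indep_var_def indep_vars_def2 by (auto split: bool.split)
qed

lemma expectation_mult_mark:
  assumes B: "B \<in> bounded_measurable (marks_algebra (- {j}))" and g: "g \<in> bounded_measurable mark_algebra"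
  shows "expectation (\<lambda>t. B t * g (X j t)) = expectation B * expectation (\<lambda>t. g (X j t))"
proof -
  have gX: "(\<lambda>t. g (X j t)) \<in> bounded_measurable (marks_algebra {j})"
    by (rule mark_function_in_marks_algebra[OF g]) simp
  have ind: "indep_var borel B borel (\<lambda>t. g (X j t))"
    by (rule indep_var_marks_algebra[OF bounded_measurableD[OF B] bounded_measurableD[OF gX]]) simp
  have 1: "integrable P B"
    by (rule integrable_bounded_measurable[OF marks_algebra_P[OF B]])
  have 2: "integrable P (\<lambda>t. g (X j t))"
    by (rule integrable_bounded_measurable[OF marks_algebra_P[OF gX]])
  show ?thesis
    by (rule indep_var_lebesgue_integral[OF ind 1 2])
qed

lemma expectation_mark_eq:
  assumes "i \<noteq> []" "j \<noteq> []" and g: "g \<in> borel_measurable mark_algebra"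
  shows "expectation (\<lambda>t. g (X i t)) = expectation (\<lambda>t. g (X j t) :: real)"
proof -
  have "distr P mark_algebra (X i) = distr P mark_algebra (X j)"
    using gw assms(1,2) unfolding gw_marks_def by blast
  then show ?thesis
    using integral_distr[OF X_measurable g] by metis
qed

lemma AE_mark_eq:
  assumes "i \<noteq> []" "j \<noteq> []" and [measurable]: "Measurable.pred mark_algebra Q"
    and "AE t in P. Q (X i t)"
  shows "AE t in P. Q (X j t)"
proof -
  have "distr P mark_algebra (X i) = distr P mark_algebra (X j)"
    using gw assms(1,2) unfolding gw_marks_def by blast
  moreover have "AE x in distr P mark_algebra (X i). Q x"
    using assms(4) by (subst AE_distr_iff) auto
  ultimately have "AE x in distr P mark_algebra (X j). Q x"
    by metis
  then show ?thesis
    by (rule AE_distrD[OF X_measurable])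
qed

text \<open>Equality of laws carries the assumption on \<open>[0]\<close> to every nonroot label;
  the root has its own assumption because its law may differ. Countability of the labels gives one
  common null set.\<close>

lemma AE_mark_deg_pos:
  assumes "prob {t \<in> space P. mark_deg (X [] t) > 0} = 1" "prob {t \<in> space P. mark_deg (X [0] t) > 0} = 1"
  shows "AE t in P. \<forall>i. mark_deg (X i t) > 0"
  unfolding AE_all_countable
proof
  fix i
  have *: "AE t in P. mark_deg (X k t) > 0" if "prob {t \<in> space P. mark_deg (X k t) > 0} = 1" for k
    using that by (subst (asm) prob_Collect_eq_1) simp_all
  show "AE t in P. mark_deg (X i t) > 0"
  proof (cases "i = []")
    case False
    show ?thesis
      by (rule AE_mark_eq[of "[0]" i "\<lambda>x. mark_deg x > 0", OF _ False _ *[OF assms(2)]]) (simp, measurable)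
  next
    case True
    show ?thesis
      unfolding True by (rule *[OF assms(1)])
  qed
qed

section \<open>Second moments of path weights, generation by generation\<close>

abbreviation wsq :: "nat list \<Rightarrow> nat \<Rightarrow> 't \<Rightarrow> real" where
  "wsq i n t \<equiv> (\<Sum>r<n. (mark_weight (X i t) r)\<^sup>2)"

abbreviation wsq_deg :: "nat list \<Rightarrow> 't \<Rightarrow> real" where
  "wsq_deg i t \<equiv> (\<Sum>r<mark_deg (X i t). (mark_weight (X i t) r)\<^sup>2)"

text \<open>Weights lie in [0, 1], so their squares are at most the weights themselves, which add up
  to at most \<open>c\<close>. This is the source of \<open>\<rho> < 1\<close>.\<close>

lemma wsq_bounds:
  assumes "t \<in> space P"
  shows "0 \<le> wsq i n t" "wsq i n t \<le> c" "wsq i n t \<le> wsq_deg i t"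
proof -
  note v = valid_markD[OF valid_mark_X[OF assms]]
  have "wsq i n t \<le> (\<Sum>r<n. mark_weight (X i t) r)"
    using v by (intro sum_mono) (simp add: power2_eq_square mult_left_le)
  also have "\<dots> \<le> c"
    using valid_mark_sum_le valid_mark_X assms c by blast
  finally show "wsq i n t \<le> c" .
  have "wsq i n t \<le> wsq i (max n (mark_deg (X i t))) t"
    by (intro sum_mono2) auto
  also have "\<dots> = wsq_deg i t"
    using v by (intro sum.mono_neutral_right) auto
  finally show "wsq i n t \<le> wsq_deg i t" .
qed (simp add: sum_nonneg)

lemma wsq_tendsto:
  assumes "t \<in> space P"
  shows "(\<lambda>n. wsq i n t) \<longlonglongrightarrow> wsq_deg i t"
proof (rule tendsto_eventually, rule eventually_sequentiallyI)
  fix n assume "mark_deg (X i t) \<le> n"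
  then show "wsq i n t = wsq_deg i t"
    using valid_markD[OF valid_mark_X[OF assms]] by (intro sum.mono_neutral_right) auto
qed

lemma wsq_in_marks_algebra: "i \<in> J \<Longrightarrow> wsq i n \<in> bounded_measurable (marks_algebra J)"
  by (intro bounded_measurable_sum bounded_measurable_power mark_function_in_marks_algebra
      bounded_measurable_mark_weight)

lemma wsq_deg_in_marks_algebra: "i \<in> J \<Longrightarrow> wsq_deg i \<in> bounded_measurable (marks_algebra J)"
proof (rule bounded_measurableI[of _ _ c])
  assume "i \<in> J"
  show "wsq_deg i \<in> borel_measurable (marks_algebra J)"
    by (rule measurable_compose[OF X_measurable_marks_algebra[OF \<open>i \<in> J\<close>] measurable_sum_lessThan_mark_deg])
      measurable
  show "\<bar>wsq_deg i t\<bar> \<le> c" if "t \<in> space (marks_algebra J)" for t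
    using wsq_bounds[of t i "mark_deg (X i t)"] that by simp
qed

lemma expectation_wsq_tendsto:
  assumes H: "H \<in> bounded_measurable P"
  shows "(\<lambda>n. expectation (\<lambda>t. H t * wsq i n t)) \<longlonglongrightarrow> expectation (\<lambda>t. H t * wsq_deg i t)"
proof -
  obtain b where b: "0 \<le> b" "\<And>t. t \<in> space P \<Longrightarrow> \<bar>H t\<bar> \<le> b"
    using H by (metis bounded_measurableE)
  show ?thesis
  proof (rule tendsto_expectation[where b="b * c"])
    show "(\<lambda>t. H t * wsq i n t) \<in> borel_measurable P" for n
      using H marks_algebra_P[OF wsq_in_marks_algebra[of i UNIV]]
      by (intro bounded_measurableD bounded_measurable_mult) auto
    show "\<bar>H t * wsq i n t\<bar> \<le> b * c" if "t \<in> space P" for t n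
      using b wsq_bounds[OF that, of i n] that by (auto simp: abs_mult intro!: mult_mono)
  qed (intro tendsto_intros wsq_tendsto)
qed

abbreviation \<rho> :: real where
  "\<rho> \<equiv> expectation (wsq_deg [0])"

lemma rho_less_1: "0 \<le> \<rho>" "\<rho> < 1"
proof -
  have "\<rho> \<le> expectation (\<lambda>t. c)"
    using wsq_bounds marks_algebra_P[OF wsq_deg_in_marks_algebra[of "[0]" UNIV]]
    by (intro integral_mono) auto
  then show "\<rho> < 1"
    using c by (simp add: prob_space)
  show "0 \<le> \<rho>"
    by (intro integral_nonneg_AE) (auto intro!: sum_nonneg)
qed

text \<open>At width \<open>n\<close> the generations form an exact geometric sequence with ratio
  \<open>r n\<close>, since extending a path by one edge multiplies by squared weights from a mark
  the path has not read. The finite geometric sum is explicit, and \<open>n\<close> is sent to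
  infinity in its closed form.\<close>

lemma expectation_sum_nonroot_words_sq_tendsto:
  assumes H: "H \<in> bounded_measurable (marks_algebra {[]})"
  shows "(\<lambda>n. expectation (\<lambda>t. H t * (\<Sum>j\<in>nonroot_words n. (pw j t)\<^sup>2)))
    \<longlonglongrightarrow> expectation (\<lambda>t. H t * wsq_deg [] t) / (1 - \<rho>)"
proof -
  define \<tau> where "\<tau> n = expectation (\<lambda>t. H t * wsq [] n t)" for n
  define r where "r n = expectation (wsq [0] n)" for n
  \<comment> \<open>\<open>H\<close> reads only the root mark and the path weight only proper
    prefixes of \<open>j\<close>; both avoid the mark of a nonroot \<open>j\<close>.\<close>
  have H': "(\<lambda>t. H t * (pw j t)\<^sup>2) \<in> bounded_measurable (marks_algebra (- {j}))" if "j \<noteq> []" for j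
    using that by (intro bounded_measurable_mult bounded_measurable_power marks_algebra_mono[OF H]
        path_weight_in_marks_algebra) (auto dest: arg_cong[where f=length])
  have int: "integrable P (\<lambda>t. H t * (pw j t)\<^sup>2)" for j
    by (intro integrable_bounded_measurable bounded_measurable_mult bounded_measurable_power
        marks_algebra_P[OF H] marks_algebra_P[OF path_weight_in_marks_algebra[of _ UNIV]]) auto
  have int_wsq: "integrable P (\<lambda>t. (H t * (pw j t)\<^sup>2) * wsq j n t)" for j n
    by (intro integrable_bounded_measurable bounded_measurable_mult bounded_measurable_power
        marks_algebra_P[OF H] marks_algebra_P[OF path_weight_in_marks_algebra[of _ UNIV]]
        marks_algebra_P[OF wsq_in_marks_algebra[of _ UNIV]]) auto
  \<comment> \<open>The first edge belongs to the root, whose mark is correlated with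
    \<open>H\<close> and may have another law. It yields the separate factor
    \<open>\<tau> n\<close>, and generation \<open>Suc l\<close> has only \<open>l\<close> factors
    \<open>r n\<close>.\<close>
  have level: "expectation (\<lambda>t. H t * (\<Sum>j\<in>words (Suc l) n. (pw j t)\<^sup>2)) = \<tau> n * r n ^ l" for l n
  proof (induction l)
    case 0
    have "words 0 n = {[]}"
      by (auto simp: words_def)
    then show ?case
      by (simp add: sum_words_Suc \<tau>_def path_weight_def)
  next
    case (Suc l)
    have "expectation (\<lambda>t. (H t * (pw j t)\<^sup>2) * wsq j n t)
        = expectation (\<lambda>t. H t * (pw j t)\<^sup>2) * r n" if "j \<in> words (Suc l) n" for j
    proof -
      have j: "j \<noteq> []"
        using that by (auto simp: words_def)
      have g: "(\<lambda>x :: 'a mark. \<Sum>r<n. (mark_weight x r)\<^sup>2) \<in> bounded_measurable mark_algebra"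
        by (intro bounded_measurable_sum bounded_measurable_power bounded_measurable_mark_weight)
      show ?thesis
        using expectation_mult_mark[OF H'[OF j] g]
          expectation_mark_eq[OF j _ bounded_measurableD[OF g], of "[0]"] by (simp add: r_def)
    qed
    then have "expectation (\<lambda>t. \<Sum>j\<in>words (Suc l) n. (H t * (pw j t)\<^sup>2) * wsq j n t)
        = expectation (\<lambda>t. \<Sum>j\<in>words (Suc l) n. H t * (pw j t)\<^sup>2) * r n"
      by (simp add: Bochner_Integration.integral_sum int int_wsq sum_distrib_right)
    moreover have "(\<Sum>j\<in>words (Suc (Suc l)) n. (pw j t)\<^sup>2) = (\<Sum>j\<in>words (Suc l) n. (pw j t)\<^sup>2 * wsq j n t)" for t
      unfolding sum_words_Suc[where l="Suc l"] by (simp add: path_weight_snoc sum_distrib_left power_mult_distrib)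
    then have "(\<lambda>t. H t * (\<Sum>j\<in>words (Suc (Suc l)) n. (pw j t)\<^sup>2))
        = (\<lambda>t. \<Sum>j\<in>words (Suc l) n. (H t * (pw j t)\<^sup>2) * wsq j n t)"
      by (simp only: sum_distrib_left[of "H _"] mult.assoc)
    ultimately show ?case
      using Suc by (simp only: sum_distrib_left[of "H _"] power_Suc2 mult.assoc)
  qed
  have r_le: "0 \<le> r n" "r n \<le> \<rho>" for n
  proof -
    show "0 \<le> r n"
      unfolding r_def by (intro integral_nonneg_AE) (auto intro!: sum_nonneg)
    show "r n \<le> \<rho>"
      unfolding r_def using wsq_bounds
        marks_algebra_P[OF wsq_deg_in_marks_algebra[of "[0]" UNIV]] marks_algebra_P[OF wsq_in_marks_algebra[of "[0]" UNIV]]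
      by (intro integral_mono) auto
  qed
  have "(\<lambda>n. \<tau> n * ((1 - r n ^ n) / (1 - r n)))
      \<longlonglongrightarrow> expectation (\<lambda>t. H t * wsq_deg [] t) * ((1 - 0) / (1 - \<rho>))"
  proof (intro tendsto_intros)
    show "\<tau> \<longlonglongrightarrow> expectation (\<lambda>t. H t * wsq_deg [] t)"
      unfolding \<tau>_def by (rule expectation_wsq_tendsto[OF marks_algebra_P[OF H]])
    show "r \<longlonglongrightarrow> \<rho>"
      using expectation_wsq_tendsto[OF bounded_measurable_const[of 1], of "[0]"] by (simp add: r_def[abs_def])
    \<comment> \<open>Base and exponent move together; the uniform bound
      \<open>r n \<le> \<rho> < 1\<close> forces the limit.\<close>
    show "(\<lambda>n. r n ^ n) \<longlonglongrightarrow> 0"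
    proof (rule tendsto_sandwich[of "\<lambda>_. 0" _ _ "\<lambda>n. \<rho> ^ n"])
      show "(\<lambda>n. \<rho> ^ n) \<longlonglongrightarrow> 0"
        using rho_less_1 by (intro LIMSEQ_power_zero) simp
    qed (use r_le in \<open>auto intro!: always_eventually power_mono\<close>)
  qed (use rho_less_1 in simp)
  moreover have "expectation (\<lambda>t. H t * (\<Sum>j\<in>nonroot_words n. (pw j t)\<^sup>2)) = \<tau> n * ((1 - r n ^ n) / (1 - r n))" for n
  proof -
    have "expectation (\<lambda>t. H t * (\<Sum>j\<in>nonroot_words n. (pw j t)\<^sup>2))
        = (\<Sum>j\<in>nonroot_words n. expectation (\<lambda>t. H t * (pw j t)\<^sup>2))"
      by (simp add: sum_distrib_left Bochner_Integration.integral_sum int)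
    also have "\<dots> = (\<Sum>l<n. expectation (\<lambda>t. H t * (\<Sum>j\<in>words (Suc l) n. (pw j t)\<^sup>2)))"
      by (simp add: sum_nonroot_words sum_distrib_left Bochner_Integration.integral_sum int)
    also have "\<dots> = \<tau> n * (\<Sum>l<n. r n ^ l)"
      unfolding level by (rule sum_distrib_left[symmetric])
    also have "(\<Sum>l<n. r n ^ l) = (1 - r n ^ n) / (1 - r n)"
      using r_le[of n] rho_less_1 by (subst sum_gp_strict) auto
    finally show ?thesis .
  qed
  ultimately show ?thesis by simp
qed

end

text \<open>What the proof uses about the signals, stated without kernels: \<open>m\<close> and
  \<open>q\<close> are the conditional first and second moments of a signal given its mark, the same
  functions for every label and time, and distinct signals are conditionally uncorrelated given all
  marks.\<close>

locale gw_signals = gw_tree P c X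
  for P :: "'t measure" and c and X :: "nat list \<Rightarrow> 't \<Rightarrow> 'a::polish_space mark" +
  fixes Z :: "nat list \<Rightarrow> nat \<Rightarrow> 't \<Rightarrow> real" and m q :: "'a mark \<Rightarrow> real"
  assumes Z_measurable [measurable]: "\<And>i s. Z i s \<in> borel_measurable P"
    and Z_bound: "\<And>i s t. t \<in> space P \<Longrightarrow> \<bar>Z i s t\<bar> \<le> 1"
    and m: "m \<in> bounded_measurable mark_algebra" and q: "q \<in> bounded_measurable mark_algebra"
    and expectation_Z: "\<And>H i s. H \<in> bounded_measurable (marks_algebra UNIV) \<Longrightarrow>
      expectation (\<lambda>t. H t * Z i s t) = expectation (\<lambda>t. H t * m (X i t))"
    and expectation_Z_sq: "\<And>H i s. H \<in> bounded_measurable (marks_algebra UNIV) \<Longrightarrow>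
      expectation (\<lambda>t. H t * (Z i s t)\<^sup>2) = expectation (\<lambda>t. H t * q (X i t))"
    and expectation_Z_mult: "\<And>H i s j r. H \<in> bounded_measurable (marks_algebra UNIV) \<Longrightarrow> (i, s) \<noteq> (j, r) \<Longrightarrow>
      expectation (\<lambda>t. H t * (Z i s t * Z j r t)) = expectation (\<lambda>t. H t * (m (X i t) * m (X j t)))"
begin

section \<open>Signals centered at their overall mean\<close>

definition \<mu> :: real where
  "\<mu> = expectation (\<lambda>t. m (X [0] t))"

text \<open>The total variance of a nonroot signal: \<open>q\<close> is averaged over the mark
  before the square of \<mu> is subtracted, so the variance of \<open>m\<close> across marks is
  included.\<close>

definition \<sigma>2 :: real where
  "\<sigma>2 = expectation (\<lambda>t. q (X [0] t)) - \<mu>\<^sup>2"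

lemma Z_bounded [intro]: "Z i s \<in> bounded_measurable P"
  by (rule bounded_measurableI[of _ _ 1]) (auto simp: Z_bound)

lemma expectation_Z_nonroot:
  assumes "j \<noteq> []"
  shows "expectation (Z j s) = \<mu>"
  using expectation_Z[of "\<lambda>_. 1" j s] expectation_mark_eq[OF assms _ bounded_measurableD[OF m], of "[0]"]
  by (simp add: \<mu>_def)

lemma variance_Z_nonroot:
  assumes "j \<noteq> []"
  shows "variance (Z j s) = \<sigma>2"
proof -
  have "integrable P (Z j s)" "integrable P (\<lambda>t. (Z j s t)\<^sup>2)"
    by (intro integrable_bounded_measurable bounded_measurable_power Z_bounded)+
  then have "variance (Z j s) = expectation (\<lambda>t. (Z j s t)\<^sup>2) - (expectation (Z j s))\<^sup>2"
    by (rule variance_eq)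
  then show ?thesis
    using expectation_Z_sq[of "\<lambda>_. 1" j s] expectation_mark_eq[OF assms _ bounded_measurableD[OF q], of "[0]"]
    by (simp add: \<sigma>2_def expectation_Z_nonroot[OF assms])
qed

text \<open>Given the marks, \<open>Z j s\<close> may be replaced by \<open>m (X j)\<close>, which
  is independent of \<open>B\<close> and has mean \<mu>.\<close>

lemma expectation_centered:
  assumes B: "B \<in> bounded_measurable (marks_algebra (- {j}))" and j: "j \<noteq> []"
  shows "expectation (\<lambda>t. B t * (Z j s t - \<mu>)) = 0"
proof -
  have "expectation (\<lambda>t. B t * (Z j s t - \<mu>)) = expectation (\<lambda>t. B t * Z j s t) - expectation B * \<mu>"
    by (simp add: right_diff_distrib Bochner_Integration.integral_diff integrable_bounded_measurable
        bounded_measurable_mult marks_algebra_P[OF B] Z_bounded)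
  also have "expectation (\<lambda>t. B t * Z j s t) = expectation (\<lambda>t. B t * m (X j t))"
    by (intro expectation_Z marks_algebra_mono[OF B]) auto
  also have "\<dots> = expectation B * \<mu>"
    using expectation_mult_mark[OF B m] expectation_mark_eq[OF j _ bounded_measurableD[OF m], of "[0]"]
    by (simp add: \<mu>_def)
  finally show ?thesis by simp
qed

text \<open>Given the marks, both signals become \<open>m\<close> of their marks. The factor
  \<open>B * m (X i)\<close> still avoids the mark of \<open>j\<close>, so the mean of
  \<open>m (X j)\<close> splits off and cancels against \<mu>. The node \<open>i\<close> may be the
  root.\<close>

lemma expectation_mult_centered:
  assumes B: "B \<in> bounded_measurable (marks_algebra (- {j}))" and j: "j \<noteq> []" "i \<noteq> j"
  shows "expectation (\<lambda>t. B t * (Z i r t * (Z j s t - \<mu>))) = 0"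
proof -
  have B': "(\<lambda>t. B t * m (X i t)) \<in> bounded_measurable (marks_algebra (- {j}))"
    using j by (intro bounded_measurable_mult B mark_function_in_marks_algebra m) auto
  have BU: "B \<in> bounded_measurable (marks_algebra UNIV)" "(\<lambda>t. B t * m (X i t)) \<in> bounded_measurable (marks_algebra UNIV)"
    using B B' by (auto intro: marks_algebra_mono)
  have "expectation (\<lambda>t. B t * (Z i r t * (Z j s t - \<mu>)))
      = expectation (\<lambda>t. B t * (Z i r t * Z j s t) - \<mu> * (B t * Z i r t))"
    by (simp add: algebra_simps)
  also have "\<dots> = expectation (\<lambda>t. B t * (Z i r t * Z j s t)) - \<mu> * expectation (\<lambda>t. B t * Z i r t)"
    by (simp add: Bochner_Integration.integral_diff integrable_bounded_measurable
        bounded_measurable_mult marks_algebra_P[OF B] Z_bounded)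
  also have "\<dots> = expectation (\<lambda>t. B t * m (X i t) * m (X j t)) - \<mu> * expectation (\<lambda>t. B t * m (X i t))"
    using j by (simp add: expectation_Z[OF BU(1)] expectation_Z_mult[OF BU(1)] mult.assoc)
  also have "\<dots> = 0"
    using expectation_mult_mark[OF B' m] expectation_mark_eq[OF j(1) _ bounded_measurableD[OF m], of "[0]"]
    by (simp add: \<mu>_def)
  finally show ?thesis .
qed

lemma expectation_centered_sq:
  assumes B: "B \<in> bounded_measurable (marks_algebra (- {j}))" and j: "j \<noteq> []"
  shows "expectation (\<lambda>t. B t * (Z j s t - \<mu>)\<^sup>2) = expectation B * \<sigma>2"
proof -
  have BU: "B \<in> bounded_measurable (marks_algebra UNIV)"
    using B by (rule marks_algebra_mono) auto
  \<comment> \<open>The square is expanded so that the linear term contains the centered signal and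
    vanishes by \<open>expectation_centered\<close>; this flips the sign of the constant
    term.\<close>
  have "expectation (\<lambda>t. B t * (Z j s t - \<mu>)\<^sup>2)
      = expectation (\<lambda>t. B t * (Z j s t)\<^sup>2 - 2 * \<mu> * (B t * (Z j s t - \<mu>)) - \<mu>\<^sup>2 * B t)"
    by (simp add: algebra_simps power2_eq_square)
  also have "\<dots> = expectation (\<lambda>t. B t * (Z j s t)\<^sup>2)
      - 2 * \<mu> * expectation (\<lambda>t. B t * (Z j s t - \<mu>)) - \<mu>\<^sup>2 * expectation B"
    by (simp add: Bochner_Integration.integral_diff integrable_bounded_measurable bounded_measurable_diff
        bounded_measurable_mult bounded_measurable_power marks_algebra_P[OF B] Z_bounded)
  also have "\<dots> = expectation (\<lambda>t. B t * q (X j t)) - \<mu>\<^sup>2 * expectation B"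
    using expectation_centered[OF B j] expectation_Z_sq[OF BU] by simp
  also have "\<dots> = expectation B * \<sigma>2"
    using expectation_mult_mark[OF B q] expectation_mark_eq[OF j _ bounded_measurableD[OF q], of "[0]"]
    by (simp add: \<sigma>2_def algebra_simps)
  finally show ?thesis .
qed

text \<open>For \<open>c + d = 1\<close> only the terms with \<open>s = l\<close> survive in the
  limiting opinion, so a node contributes exactly one signal, that of time
  \<open>length j\<close>.\<close>

abbreviation Y :: "nat list \<Rightarrow> 't \<Rightarrow> real" where
  "Y j t \<equiv> Z j (length j) t - \<mu>"

abbreviation Sn :: "nat \<Rightarrow> 't \<Rightarrow> real" where
  "Sn n t \<equiv> (\<Sum>j\<in>nonroot_words n. pw j t * Y j t)"

definition S :: "'t \<Rightarrow> real" where
  "S t = (\<Sum>l. \<Sum>j\<in>gw_layer (\<lambda>i. X i t) (Suc l). pw j t * Y j t)"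

text \<open>Proper prefixes of \<open>i\<close> and of \<open>j\<close> are strictly shorter than
  \<open>j\<close>, hence different from it. Equal generations are covered as well.\<close>

lemma path_weight_avoid:
  assumes "length i \<le> length j" "i \<noteq> j"
  shows "pw i \<in> bounded_measurable (marks_algebra (- {j}))" "pw j \<in> bounded_measurable (marks_algebra (- {j}))"
  using assms by (auto intro!: path_weight_in_marks_algebra dest: arg_cong[where f=length])

lemma path_weight_bounded [intro]: "pw j \<in> bounded_measurable P"
  by (rule marks_algebra_P[OF path_weight_in_marks_algebra[of _ UNIV]]) simp

lemma Y_bounded [intro]: "Y j \<in> bounded_measurable P"
  by (intro bounded_measurable_diff Z_bounded bounded_measurable_const)

lemma Sn_bounded [intro]: "Sn n \<in> bounded_measurable P"
  by (intro bounded_measurable_sum bounded_measurable_mult path_weight_bounded Y_bounded)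

lemma orthogonal:
  assumes H: "H \<in> bounded_measurable (marks_algebra {[]})" and ij: "i \<noteq> []" "j \<noteq> []" "i \<noteq> j"
  shows "expectation (\<lambda>t. H t * ((pw i t * Y i t) * (pw j t * Y j t))) = 0"
proof -
  \<comment> \<open>The claim is symmetric in the two nodes, so \<open>j\<close> may be taken in the
    generation that is at least as late. Then \<open>B\<close> below gathers \<open>H\<close> and
    both path weights and avoids the mark of \<open>j\<close>.\<close>
  have le: "expectation (\<lambda>t. H t * ((pw i t * Y i t) * (pw j t * Y j t))) = 0"
    if ij: "i \<noteq> []" "j \<noteq> []" "i \<noteq> j" and le: "length i \<le> length j" for i j
  proof -
  define B where "B t = H t * (pw i t * pw j t)" for t
  have B: "B \<in> bounded_measurable (marks_algebra (- {j}))"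
    unfolding B_def[abs_def] using ij path_weight_avoid[OF le]
    by (intro bounded_measurable_mult marks_algebra_mono[OF H]) auto
  have "expectation (\<lambda>t. H t * ((pw i t * Y i t) * (pw j t * Y j t)))
      = expectation (\<lambda>t. B t * (Z i (length i) t * Y j t) - \<mu> * (B t * Y j t))"
    by (simp add: B_def algebra_simps)
  also have "\<dots> = expectation (\<lambda>t. B t * (Z i (length i) t * Y j t)) - \<mu> * expectation (\<lambda>t. B t * Y j t)"
    by (simp add: Bochner_Integration.integral_diff integrable_bounded_measurable
        bounded_measurable_mult bounded_measurable_diff marks_algebra_P[OF B] Z_bounded)
  also have "\<dots> = 0"
    using expectation_mult_centered[OF B] expectation_centered[OF B] ij by simp
  finally show ?thesis .
qed
  show ?thesis
  proof (cases "length i \<le> length j")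
    case True
    then show ?thesis
      using ij by (intro le) auto
  next
    case False
    then have "expectation (\<lambda>t. H t * ((pw j t * Y j t) * (pw i t * Y i t))) = 0"
      using ij by (intro le) auto
    then show ?thesis
      by (simp only: mult.commute[of "pw j _ * Y j _"])
  qed
qed

lemma expectation_Sn:
  assumes H: "H \<in> bounded_measurable (marks_algebra {[]})"
  shows "expectation (\<lambda>t. H t * Sn n t) = 0"
    and "expectation (\<lambda>t. H t * ((Z [] r t - m (X [] t)) * Sn n t)) = 0"
    and "expectation (\<lambda>t. H t * (Sn n t)\<^sup>2) = \<sigma>2 * expectation (\<lambda>t. H t * (\<Sum>j\<in>nonroot_words n. (pw j t)\<^sup>2))"
proof -
  note HP = marks_algebra_P[OF H]
  have mX: "(\<lambda>t. m (X [] t)) \<in> bounded_measurable P"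
    by (intro bounded_measurable_compose[OF m]) simp
  have B: "(\<lambda>t. H t * pw j t) \<in> bounded_measurable (marks_algebra (- {j}))"
    "(\<lambda>t. H t * pw j t * m (X [] t)) \<in> bounded_measurable (marks_algebra (- {j}))"
    "(\<lambda>t. H t * (pw j t)\<^sup>2) \<in> bounded_measurable (marks_algebra (- {j}))" if "j \<noteq> []" for j
    using that path_weight_avoid[of "[]" j]
    by (auto intro!: bounded_measurable_mult bounded_measurable_power marks_algebra_mono[OF H]
        mark_function_in_marks_algebra[OF m])
  have "expectation (\<lambda>t. H t * Sn n t) = (\<Sum>j\<in>nonroot_words n. expectation (\<lambda>t. H t * pw j t * Y j t))"
    by (simp add: sum_distrib_left mult.assoc Bochner_Integration.integral_sum integrable_bounded_measurable
        bounded_measurable_mult HP path_weight_bounded Y_bounded)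
  also have "\<dots> = 0"
    by (intro sum.neutral ballI expectation_centered B) (auto dest: Nil_notin_nonroot_words)
  finally show "expectation (\<lambda>t. H t * Sn n t) = 0" .
  \<comment> \<open>The zero comes from the centered signal of \<open>j\<close>, separately for
    \<open>Z []\<close> and for \<open>m (X [])\<close>: the root is a node other than
    \<open>j\<close>, and its mark is independent of that of \<open>j\<close>.\<close>
  have root: "expectation (\<lambda>t. H t * pw j t * ((Z [] r t - m (X [] t)) * Y j t)) = 0" if "j \<noteq> []" for j
  proof -
    have "expectation (\<lambda>t. H t * pw j t * ((Z [] r t - m (X [] t)) * Y j t))
        = expectation (\<lambda>t. H t * pw j t * (Z [] r t * Y j t) - H t * pw j t * m (X [] t) * Y j t)"
      by (simp add: algebra_simps)
    also have "\<dots> = expectation (\<lambda>t. H t * pw j t * (Z [] r t * Y j t))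
        - expectation (\<lambda>t. H t * pw j t * m (X [] t) * Y j t)"
      by (intro Bochner_Integration.integral_diff integrable_bounded_measurable
        bounded_measurable_mult HP path_weight_bounded Y_bounded Z_bounded mX)
    also have "\<dots> = 0"
      using expectation_mult_centered[OF B(1)[OF that] that, of "[]"] expectation_centered[OF B(2)[OF that] that] that
      by simp
    finally show ?thesis .
  qed
  have "expectation (\<lambda>t. H t * ((Z [] r t - m (X [] t)) * Sn n t))
      = expectation (\<lambda>t. \<Sum>j\<in>nonroot_words n. H t * pw j t * ((Z [] r t - m (X [] t)) * Y j t))"
    by (simp add: sum_distrib_left ac_simps)
  also have "\<dots> = (\<Sum>j\<in>nonroot_words n. expectation (\<lambda>t. H t * pw j t * ((Z [] r t - m (X [] t)) * Y j t)))"
    by (intro Bochner_Integration.integral_sum integrable_bounded_measurable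
        bounded_measurable_mult bounded_measurable_diff HP path_weight_bounded Y_bounded Z_bounded mX)
  also have "\<dots> = 0"
    by (intro sum.neutral ballI root) (auto dest: Nil_notin_nonroot_words)
  finally show "expectation (\<lambda>t. H t * ((Z [] r t - m (X [] t)) * Sn n t)) = 0" .
  have "expectation (\<lambda>t. H t * (Sn n t)\<^sup>2)
      = expectation (\<lambda>t. \<Sum>i\<in>nonroot_words n. \<Sum>j\<in>nonroot_words n. H t * ((pw i t * Y i t) * (pw j t * Y j t)))"
    unfolding power2_eq_square sum_product by (simp only: sum_distrib_left)
  also have "\<dots> = (\<Sum>i\<in>nonroot_words n. \<Sum>j\<in>nonroot_words n. expectation (\<lambda>t. H t * ((pw i t * Y i t) * (pw j t * Y j t))))"
    by (simp add: Bochner_Integration.integral_sum integrable_bounded_measurable bounded_measurable_sum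
        bounded_measurable_mult HP path_weight_bounded Y_bounded)
  \<comment> \<open>Off the diagonal the terms are orthogonal; on it the squared path weight avoids
    the mark of \<open>i\<close>, so the variance of the signal factors out.\<close>
  also have "\<dots> = (\<Sum>i\<in>nonroot_words n. \<Sum>j\<in>nonroot_words n. if i = j then expectation (\<lambda>t. H t * (pw i t)\<^sup>2) * \<sigma>2 else 0)"
  proof (intro sum.cong refl)
    fix i j assume "i \<in> nonroot_words n" "j \<in> nonroot_words n"
    then have ij: "i \<noteq> []" "j \<noteq> []"
      by (auto dest: Nil_notin_nonroot_words)
    have "expectation (\<lambda>t. H t * ((pw i t * Y i t) * (pw i t * Y i t))) = expectation (\<lambda>t. H t * (pw i t)\<^sup>2 * (Y i t)\<^sup>2)"
      by (simp add: power2_eq_square ac_simps)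
    then show "expectation (\<lambda>t. H t * ((pw i t * Y i t) * (pw j t * Y j t)))
      = (if i = j then expectation (\<lambda>t. H t * (pw i t)\<^sup>2) * \<sigma>2 else 0)"
      using orthogonal[OF H ij] expectation_centered_sq[OF B(3)[OF ij(1)] ij(1)] by (cases "i = j") simp_all
  qed
  also have "\<dots> = (\<Sum>i\<in>nonroot_words n. expectation (\<lambda>t. H t * (pw i t)\<^sup>2)) * \<sigma>2"
    by (simp add: sum_distrib_right)
  also have "(\<Sum>i\<in>nonroot_words n. expectation (\<lambda>t. H t * (pw i t)\<^sup>2)) = expectation (\<lambda>t. H t * (\<Sum>j\<in>nonroot_words n. (pw j t)\<^sup>2))"
    by (simp add: sum_distrib_left Bochner_Integration.integral_sum integrable_bounded_measurable
        bounded_measurable_mult bounded_measurable_power HP path_weight_bounded)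
  finally show "expectation (\<lambda>t. H t * (Sn n t)\<^sup>2) = \<sigma>2 * expectation (\<lambda>t. H t * (\<Sum>j\<in>nonroot_words n. (pw j t)\<^sup>2))"
    by (simp add: mult.commute)
qed

lemma Y_le: "t \<in> space P \<Longrightarrow> \<bar>Y j t\<bar> \<le> 1 + \<bar>\<mu>\<bar>"
  using Z_bound[of t j "length j"] by linarith

lemma Sn_tendsto: "t \<in> space P \<Longrightarrow> (\<lambda>n. Sn n t) \<longlonglongrightarrow> S t"
  unfolding S_def by (rule valid_tree.sum_nonroot_words_tendsto[OF valid_tree_X Y_le])

lemma Sn_le: "t \<in> space P \<Longrightarrow> \<bar>Sn n t\<bar> \<le> (1 + \<bar>\<mu>\<bar>) / (1 - c)"
  by (rule valid_tree.abs_sum_nonroot_words_le[OF valid_tree_X Y_le])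

text \<open>\<open>S\<close> sums over random sets of nodes; its measurability and bound are
  inherited from the deterministic finite sums \<open>Sn\<close>.\<close>

lemma S_bounded [intro]: "S \<in> bounded_measurable P"
proof (rule bounded_measurableI)
  show "S \<in> borel_measurable P"
    by (rule borel_measurable_LIMSEQ_real[OF Sn_tendsto bounded_measurableD[OF Sn_bounded]])
  show "\<bar>S t\<bar> \<le> (1 + \<bar>\<mu>\<bar>) / (1 - c)" if "t \<in> space P" for t
    using tendsto_rabs[OF Sn_tendsto[OF that]] Sn_le[OF that] by (intro LIMSEQ_le_const2) auto
qed

lemma expectation_Sn_tendsto:
  assumes H: "H \<in> bounded_measurable P"
  shows "(\<lambda>n. expectation (\<lambda>t. H t * Sn n t ^ k)) \<longlonglongrightarrow> expectation (\<lambda>t. H t * S t ^ k)"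
proof -
  obtain b where b: "0 \<le> b" "\<And>t. t \<in> space P \<Longrightarrow> \<bar>H t\<bar> \<le> b"
    using H by (metis bounded_measurableE)
  show ?thesis
  proof (rule tendsto_expectation)
    show "(\<lambda>t. H t * Sn n t ^ k) \<in> borel_measurable P" for n
      by (intro bounded_measurableD bounded_measurable_mult bounded_measurable_power H Sn_bounded)
    show "\<bar>H t * Sn n t ^ k\<bar> \<le> b * ((1 + \<bar>\<mu>\<bar>) / (1 - c)) ^ k" if "t \<in> space P" for t n
      unfolding abs_mult power_abs using b that by (intro mult_mono power_mono Sn_le) auto
    show "(\<lambda>n. H t * Sn n t ^ k) \<longlonglongrightarrow> H t * S t ^ k" if "t \<in> space P" for t
      by (intro tendsto_intros Sn_tendsto that)
  qed
qed

lemma expectation_S: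
  assumes H: "H \<in> bounded_measurable (marks_algebra {[]})"
  shows "expectation (\<lambda>t. H t * S t) = 0"
    and "expectation (\<lambda>t. H t * ((Z [] r t - m (X [] t)) * S t)) = 0"
    and "expectation (\<lambda>t. H t * (S t)\<^sup>2) = \<sigma>2 * (expectation (\<lambda>t. H t * wsq_deg [] t) / (1 - \<rho>))"
proof -
  note HP = marks_algebra_P[OF H]
  show "expectation (\<lambda>t. H t * S t) = 0"
    using expectation_Sn_tendsto[OF HP, of 1] by (simp add: expectation_Sn(1)[OF H] LIMSEQ_const_iff)
  have HP': "(\<lambda>t. H t * (Z [] r t - m (X [] t))) \<in> bounded_measurable P"
    by (intro bounded_measurable_mult bounded_measurable_diff HP Z_bounded bounded_measurable_compose[OF m]) simp
  show "expectation (\<lambda>t. H t * ((Z [] r t - m (X [] t)) * S t)) = 0"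
    using expectation_Sn_tendsto[OF HP', of 1]
    by (simp add: expectation_Sn(2)[OF H] LIMSEQ_const_iff mult.assoc)
  \<comment> \<open>One sequence has two limits: dominated convergence gives the left side, the
    geometric sum of squared path weights the right side.\<close>
  show "expectation (\<lambda>t. H t * (S t)\<^sup>2) = \<sigma>2 * (expectation (\<lambda>t. H t * wsq_deg [] t) / (1 - \<rho>))"
    using expectation_Sn_tendsto[OF HP, of 2] tendsto_mult_left[OF expectation_sum_nonroot_words_sq_tendsto[OF H]]
    unfolding expectation_Sn(3)[OF H] by (rule LIMSEQ_unique)
qed

end

section \<open>Conditional moments of the media signals\<close>

context gw_tree
begin

text \<open>Boundedness is demanded on all of \<open>mark_space\<close>, where weight sums are
  unbounded, and on the whole real line. Truncation supplies it and changes no value that the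
  variables actually take.\<close>

abbreviation clip :: "real \<Rightarrow> real \<Rightarrow> real" where
  "clip b y \<equiv> max (- b) (min b y)"

lemma clip_bounded [intro]: "f \<in> borel_measurable N \<Longrightarrow> (\<lambda>x. clip b (f x)) \<in> bounded_measurable N"
  by (rule bounded_measurableI[of _ _ "\<bar>b\<bar>"]) auto

text \<open>Given the mark, the full signal is an affine function of \<open>Z\<close> with slope
  \<open>d > 0\<close> and offset \<open>g\<close>. Inverting this map expresses the moments of
  \<open>Z\<close> through those of \<nu>.\<close>

lemma gw_signals_of_media:
  assumes d: "0 < d" "c + d = 1"
    and \<nu>: "\<nu> \<in> mark_algebra \<rightarrow>\<^sub>M prob_algebra borel"
    and media: "media_signals c d \<nu> P X Z"
  shows "\<exists>m q. gw_signals P c X Z m q"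
proof -
  let ?F = "marks_algebra UNIV"
  have F: "vimage_algebra (space P) (\<lambda>t i. X i t) (PiM UNIV (\<lambda>_. mark_algebra)) = ?F"
    by (simp add: marks_algebra_def restrict_def)
  have Zb: "\<bar>Z i k t\<bar> \<le> 1" if "t \<in> space P" for i k t
    using media that by (auto simp: media_signals_def Let_def abs_le_iff minus_le_iff)
  have ind: "cond_indep_vars P ?F borel (\<lambda>(i, k). Z i k) UNIV"
    and law: "has_cond_law P ?F borel (media_signal c d X Z i k) (\<lambda>t. \<nu> (X i t))" for i k
    using media by (simp_all add: media_signals_def Let_def F)
  have Zm [measurable]: "Z i k \<in> borel_measurable P" for i k
    using ind by (auto simp: cond_indep_vars_def split: prod.splits)
  have Zbm: "Z i k \<in> bounded_measurable P" for i k
    by (rule bounded_measurableI[of _ _ 1]) (auto simp: Zb)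
  define g :: "'a mark \<Rightarrow> real" where "g x = clip 1 (mark_opinion x * (c - mark_weight_sum x))" for x
  \<comment> \<open>The truncation level is 2 because the signal is \<open>d * Z\<close> plus
    \<open>g\<close>, both of absolute value at most 1.\<close>
  define n1 where "n1 x = (\<integral>y. clip 2 y \<partial>\<nu> x)" for x
  define n2 where "n2 x = (\<integral>y. (clip 2 y)\<^sup>2 \<partial>\<nu> x)" for x
  \<comment> \<open>The first two moments of \<open>(y - g x) / d\<close> for \<open>y\<close>
    distributed as \<open>\<nu> x\<close>.\<close>
  define m where "m x = (n1 x - g x) / d" for x
  define q where "q x = (n2 x - 2 * (g x * n1 x) + g x * g x) / d\<^sup>2" for x
  have gb: "g \<in> bounded_measurable mark_algebra"
    unfolding g_def[abs_def] by (rule clip_bounded) measurable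
  have clip2: "clip 2 \<in> bounded_measurable borel" "(\<lambda>y. (clip 2 y)\<^sup>2) \<in> bounded_measurable borel"
    by (intro bounded_measurable_power clip_bounded; simp)+
  have nb: "n1 \<in> bounded_measurable mark_algebra" "n2 \<in> bounded_measurable mark_algebra"
    unfolding n1_def[abs_def] n2_def[abs_def] by (rule bounded_measurable_kernel[OF \<nu> clip2(1)] bounded_measurable_kernel[OF \<nu> clip2(2)])+
  have mb: "m \<in> bounded_measurable mark_algebra"
    unfolding m_def[abs_def] by (intro bounded_measurable_divide bounded_measurable_diff nb gb)
  have qb: "q \<in> bounded_measurable mark_algebra"
    unfolding q_def[abs_def]
    by (intro bounded_measurable_divide bounded_measurable_diff bounded_measurable_add bounded_measurable_mult
        bounded_measurable_const nb gb)
  \<comment> \<open>For a valid mark the opinion is at most 1 in absolute value, and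
    \<open>c\<close> minus the weight sum is 0 or \<open>c\<close>, so the truncation in
    \<open>g\<close> is inactive.\<close>
  have W: "media_signal c d X Z i k t = d * Z i k t + g (X i t)" if "t \<in> space P" for i k t
  proof -
    note v = valid_mark_X[OF that, of i]
    have "\<bar>mark_opinion (X i t)\<bar> \<le> 1"
      using valid_markD(4)[OF v] by (cases "X i t") (auto simp: mark_space_def)
    moreover have "\<bar>c - mark_weight_sum (X i t)\<bar> \<le> 1"
      using valid_markD(5)[OF v] c by (cases "mark_deg (X i t) > 0") (auto simp: mark_weight_sum_def)
    ultimately have "\<bar>mark_opinion (X i t) * (c - mark_weight_sum (X i t))\<bar> \<le> 1"
      unfolding abs_mult by (intro mult_le_one) auto
    then show ?thesis
      unfolding media_signal_def g_def by (simp add: abs_le_iff)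
  qed
  have clipW: "clip 2 (media_signal c d X Z i k t) = d * Z i k t + g (X i t)" if t: "t \<in> space P" for i k t
  proof -
    have "\<bar>d * Z i k t\<bar> \<le> 1"
      unfolding abs_mult using Zb[OF t] d c by (intro mult_le_one) auto
    moreover have "\<bar>g (X i t)\<bar> \<le> 1"
      by (simp add: g_def)
    ultimately show ?thesis
      unfolding W[OF t] by linarith
  qed
  have gX: "(\<lambda>t. g (X i t)) \<in> bounded_measurable ?F" for i
    by (rule mark_function_in_marks_algebra[OF gb]) simp
  have kernel: "expectation (\<lambda>t. H t * f (media_signal c d X Z i k t)) = expectation (\<lambda>t. H t * (\<integral>y. f y \<partial>\<nu> (X i t)))"
    if H: "H \<in> bounded_measurable ?F" and f: "f \<in> bounded_measurable borel" for H f i k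
    by (rule expectation_mult_cond_law[OF law subalgebra_marks_algebra measurable_compose[OF X_measurable_marks_algebra \<nu>] f _ H])
      (simp_all add: mark_function_in_marks_algebra[OF bounded_measurable_kernel[OF \<nu> f]])
  have E1: "expectation (\<lambda>t. H t * Z i k t) = expectation (\<lambda>t. H t * m (X i t))"
    if H: "H \<in> bounded_measurable ?F" for H i k
  proof -
    note HP = marks_algebra_P[OF H] and gP = marks_algebra_P[OF gX]
    have n1X: "(\<lambda>t. n1 (X i t)) \<in> bounded_measurable P"
      by (rule bounded_measurable_compose[OF nb(1)]) simp
    have "d * expectation (\<lambda>t. H t * Z i k t) + expectation (\<lambda>t. H t * g (X i t))
        = expectation (\<lambda>t. d * (H t * Z i k t) + H t * g (X i t))"
      by (simp add: Bochner_Integration.integral_add integrable_bounded_measurable bounded_measurable_mult HP gP Zbm)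
    also have "\<dots> = expectation (\<lambda>t. H t * clip 2 (media_signal c d X Z i k t))"
      by (intro Bochner_Integration.integral_cong refl) (simp only: clipW, simp add: algebra_simps)
    also have "\<dots> = expectation (\<lambda>t. H t * n1 (X i t))"
      unfolding n1_def by (rule kernel[OF H clip2(1)])
    finally have "expectation (\<lambda>t. H t * Z i k t)
        = (expectation (\<lambda>t. H t * n1 (X i t)) - expectation (\<lambda>t. H t * g (X i t))) / d"
      using d by (simp add: field_simps)
    also have "expectation (\<lambda>t. H t * n1 (X i t)) - expectation (\<lambda>t. H t * g (X i t))
        = expectation (\<lambda>t. H t * n1 (X i t) - H t * g (X i t))"
      by (simp add: Bochner_Integration.integral_diff integrable_bounded_measurable bounded_measurable_mult HP gP n1X)
    also have "\<dots> / d = expectation (\<lambda>t. (H t * n1 (X i t) - H t * g (X i t)) / d)"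
      by simp
    also have "\<dots> = expectation (\<lambda>t. H t * m (X i t))"
      by (simp add: m_def right_diff_distrib)
    finally show ?thesis .
  qed
  have E2: "expectation (\<lambda>t. H t * (Z i k t)\<^sup>2) = expectation (\<lambda>t. H t * q (X i t))"
    if H: "H \<in> bounded_measurable ?F" for H i k
  proof -
    note HP = marks_algebra_P[OF H] and gP = marks_algebra_P[OF gX]
    have nX: "(\<lambda>t. n1 (X i t)) \<in> bounded_measurable P" "(\<lambda>t. n2 (X i t)) \<in> bounded_measurable P"
      "(\<lambda>t. m (X i t)) \<in> bounded_measurable P"
      by (rule bounded_measurable_compose[OF nb(1)] bounded_measurable_compose[OF nb(2)]
          bounded_measurable_compose[OF mb]; simp)+
    \<comment> \<open>The cross term of the square is a first moment with weight
      \<open>H * g\<close>, so \<open>E1\<close> evaluates it.\<close>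
    have Hg: "(\<lambda>t. H t * g (X i t)) \<in> bounded_measurable ?F"
      by (intro bounded_measurable_mult H gX)
    have "d\<^sup>2 * expectation (\<lambda>t. H t * (Z i k t)\<^sup>2) + 2 * d * expectation (\<lambda>t. H t * g (X i t) * Z i k t)
          + expectation (\<lambda>t. H t * (g (X i t) * g (X i t)))
        = expectation (\<lambda>t. d\<^sup>2 * (H t * (Z i k t)\<^sup>2) + 2 * d * (H t * g (X i t) * Z i k t) + H t * (g (X i t) * g (X i t)))"
      by (simp add: Bochner_Integration.integral_add integrable_bounded_measurable bounded_measurable_mult
          bounded_measurable_power bounded_measurable_add HP gP Zbm)
    also have "\<dots> = expectation (\<lambda>t. H t * (clip 2 (media_signal c d X Z i k t))\<^sup>2)"
      by (intro Bochner_Integration.integral_cong refl)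
        (simp only: clipW, simp add: algebra_simps power2_eq_square)
    also have "\<dots> = expectation (\<lambda>t. H t * n2 (X i t))"
      unfolding n2_def by (rule kernel[OF H clip2(2)])
    finally have "expectation (\<lambda>t. H t * (Z i k t)\<^sup>2)
        = (expectation (\<lambda>t. H t * n2 (X i t)) - 2 * d * expectation (\<lambda>t. H t * g (X i t) * m (X i t))
          - expectation (\<lambda>t. H t * (g (X i t) * g (X i t)))) / d\<^sup>2"
      unfolding E1[OF Hg] using d by (simp add: field_simps)
    also have "expectation (\<lambda>t. H t * n2 (X i t)) - 2 * d * expectation (\<lambda>t. H t * g (X i t) * m (X i t))
          - expectation (\<lambda>t. H t * (g (X i t) * g (X i t)))
        = expectation (\<lambda>t. H t * n2 (X i t) - 2 * d * (H t * g (X i t) * m (X i t)) - H t * (g (X i t) * g (X i t)))"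
      by (simp add: Bochner_Integration.integral_diff integrable_bounded_measurable bounded_measurable_mult
          bounded_measurable_diff HP gP nX)
    also have "\<dots> / d\<^sup>2 = expectation (\<lambda>t. (H t * n2 (X i t) - 2 * d * (H t * g (X i t) * m (X i t))
        - H t * (g (X i t) * g (X i t))) / d\<^sup>2)"
      by simp
    \<comment> \<open>Substituting \<open>d * m = n1 - g\<close> turns
      \<open>n2 - 2 * d * g * m - g * g\<close> into the numerator of \<open>q\<close>.\<close>
    also have "\<dots> = expectation (\<lambda>t. H t * q (X i t))"
      using d by (simp add: m_def q_def algebra_simps add_divide_distrib diff_divide_distrib)
    finally show ?thesis .
  qed
  interpret FF: sigma_finite_subalgebra P ?F
    by (rule sigma_finite_subalgebraI[OF subalgebra_marks_algebra])
  have cond_Z: "AE t in P. real_cond_exp P ?F (Z i k) t = m (X i t)" for i k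
  proof -
    have mX: "(\<lambda>t. m (X i t)) \<in> bounded_measurable ?F"
      by (rule mark_function_in_marks_algebra[OF mb]) simp
    show ?thesis
      using E1[OF bounded_measurable_indicator, of _ i k]
      by (intro FF.real_cond_exp_charact integrable_bounded_measurable Zbm marks_algebra_P[OF mX] bounded_measurableD[OF mX])
        (simp add: set_lebesgue_integral_def)
  qed
  have E3: "expectation (\<lambda>t. H t * (Z i s t * Z j r t)) = expectation (\<lambda>t. H t * (m (X i t) * m (X j t)))"
    if H: "H \<in> bounded_measurable ?F" and ne: "(i, s) \<noteq> (j, r)" for H i s j r
  proof -
    have mX: "(\<lambda>t. m (X i t)) \<in> bounded_measurable ?F"
      by (rule mark_function_in_marks_algebra[OF mb]) simp
    \<comment> \<open>The identity is not bounded on the reals; truncation at level 1 fixes the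
      signals and makes \<open>integral_mult_cond_indep\<close> applicable.\<close>
    have clip1: "clip 1 \<in> bounded_measurable borel"
      by (rule clip_bounded) simp
    have clipZ: "clip 1 (Z i s t) = Z i s t" if "t \<in> space P" for i s t
      using Zb[OF that, of i s] by linarith
    note [measurable] = bounded_measurableD[OF marks_algebra_P[OF H]] bounded_measurableD[OF marks_algebra_P[OF mX]]
    have "AE t in P. real_cond_exp P ?F (\<lambda>t. clip 1 (Z i s t)) t = real_cond_exp P ?F (Z i s) t"
      by (rule FF.real_cond_exp_cong) (auto simp: clipZ simp del: max_def)
    then have *: "AE t in P. real_cond_exp P ?F (\<lambda>t. clip 1 (Z i s t)) t = m (X i t)"
      using cond_Z[of i s] by eventually_elim simp
    have "expectation (\<lambda>t. H t * (Z i s t * Z j r t)) = expectation (\<lambda>t. H t * (clip 1 (Z i s t) * clip 1 (Z j r t)))"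
      by (intro Bochner_Integration.integral_cong refl) (simp only: clipZ)
    also have "\<dots> = expectation (\<lambda>t. H t * (real_cond_exp P ?F (\<lambda>t. clip 1 (Z i s t)) t * clip 1 (Z j r t)))"
      using integral_mult_cond_indep[OF ind subalgebra_marks_algebra, of "(i, s)" "(j, r)" "clip 1" "clip 1" H]
        ne H clip1 by simp
    also have "\<dots> = expectation (\<lambda>t. H t * m (X i t) * Z j r t)"
    proof (rule integral_cong_AE)
      show "AE t in P. H t * (real_cond_exp P ?F (\<lambda>t. clip 1 (Z i s t)) t * clip 1 (Z j r t))
          = H t * m (X i t) * Z j r t"
        using * AE_space by eventually_elim (simp only: clipZ mult.assoc)
    qed measurable
    \<comment> \<open>The second signal is now averaged by the first-moment identity with weight
      \<open>H * m (X i)\<close>.\<close>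
    also have "\<dots> = expectation (\<lambda>t. H t * m (X i t) * m (X j t))"
      by (rule E1[OF bounded_measurable_mult[OF H mX]])
    finally show ?thesis
      by (simp only: mult.assoc)
  qed
  have "gw_signals P c X Z m q"
    by unfold_locales (fact Zm Zb mb qb E1 E2 E3)+
  then show ?thesis by blast
qed

end

section \<open>Decomposition of the limiting opinion\<close>

context gw_signals
begin

lemma media_signal_measurable: "media_signal c d X Z i k \<in> borel_measurable P"
  unfolding media_signal_def[abs_def] by measurable

abbreviation R :: "real \<Rightarrow> 't \<Rightarrow> real" where
  "R d t \<equiv> limit_opinion c d (\<lambda>i. X i t) (\<lambda>i s. media_signal c d X Z i s t)"

text \<open>The base \<open>1 - c - d\<close> is 0, and \<open>0 ^ (s - l)\<close> is 1 for
  \<open>l = s\<close> and 0 otherwise.\<close>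

lemma limit_opinion_eq:
  assumes "c + d = 1"
  shows "R d t = (\<Sum>s. \<Sum>j\<in>gw_layer (\<lambda>i. X i t) s. pw j t * media_signal c d X Z j s t)"
proof -
  have "1 - c - d = 0"
    using assms by simp
  then have "(\<Sum>l\<le>s. \<Sum>j\<in>gw_layer (\<lambda>i. X i t) l.
        pw j t * real (s choose l) * (1 - c - d) ^ (s - l) * media_signal c d X Z j s t)
      = (\<Sum>l\<le>s. if l = s then \<Sum>j\<in>gw_layer (\<lambda>i. X i t) s. pw j t * media_signal c d X Z j s t else 0)" for s
    by (intro sum.cong) (auto simp: power_0_left)
  then show ?thesis
    by (simp add: limit_opinion_def gw_layer_def)
qed

lemma limit_opinion_measurable:
  assumes "c + d = 1"
  shows "R d \<in> borel_measurable P"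
  unfolding limit_opinion_eq[OF assms]
proof (rule borel_measurable_suminf)
  fix s
  show "(\<lambda>t. \<Sum>j\<in>gw_layer (\<lambda>i. X i t) s. pw j t * media_signal c d X Z j s t) \<in> borel_measurable P"
  proof (rule borel_measurable_LIMSEQ_real)
    show "(\<lambda>n. \<Sum>j\<in>words s n. pw j t * media_signal c d X Z j s t)
        \<longlonglongrightarrow> (\<Sum>j\<in>gw_layer (\<lambda>i. X i t) s. pw j t * media_signal c d X Z j s t)" if "t \<in> space P" for t
      by (rule valid_tree.sum_words_path_weight_tendsto[OF valid_tree_X[OF that]])
    show "(\<lambda>t. \<Sum>j\<in>words s n. pw j t * media_signal c d X Z j s t) \<in> borel_measurable P" for n
      by (intro borel_measurable_sum borel_measurable_times media_signal_measurable
          bounded_measurableD[OF path_weight_bounded])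
  qed
qed

text \<open>With every node fertile, generation \<open>s\<close> has total path weight
  \<open>c ^ s\<close>, so the means contribute \<open>d * \<mu> * c ^ s\<close>. Their sum is \<mu>
  because \<open>d = 1 - c\<close>; uncentering the root signal takes back \<open>d * \<mu>\<close>
  and leaves \<open>c * \<mu>\<close>.\<close>

lemma limit_opinion_decomposition:
  assumes d: "c + d = 1" and t: "t \<in> space P" and deg: "\<And>i. mark_deg (X i t) > 0"
  shows "R d t = d * Z [] 0 t + c * \<mu> + d * S t"
proof -
  interpret V: valid_tree c "\<lambda>i. X i t"
    by (rule valid_tree_X[OF t])
  let ?L = "gw_layer (\<lambda>i. X i t)"
  \<comment> \<open>The weights of the children sum to \<open>c\<close>, which cancels the opinion
    term.\<close>
  have W: "media_signal c d X Z j s t = d * Z j s t" for j s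
    using valid_markD(5)[OF valid_mark_X[OF t] deg] by (simp add: media_signal_def)
  define a where "a s = (\<Sum>j\<in>?L s. pw j t * Y j t)" for s
  have layer: "(\<Sum>j\<in>?L s. pw j t * media_signal c d X Z j s t) = d * a s + d * \<mu> * c ^ s" for s
  proof -
    have "(\<Sum>j\<in>?L s. pw j t * media_signal c d X Z j s t) = (\<Sum>j\<in>?L s. d * (pw j t * Y j t) + d * \<mu> * pw j t)"
      by (intro sum.cong refl) (auto simp: W gw_layer_def algebra_simps)
    also have "\<dots> = d * a s + d * \<mu> * (\<Sum>j\<in>?L s. pw j t)"
      by (simp only: sum.distrib sum_distrib_left a_def)
    finally show ?thesis
      using V.sum_gw_layer_path_weight[OF deg] by simp
  qed
  have sa: "summable a"
    unfolding a_def by (rule V.summable_gw_layer[OF Y_le[OF t]])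
  have sc: "summable (\<lambda>s. c ^ s)" "(\<Sum>s. c ^ s) = 1 / (1 - c)"
    using c by (simp_all add: summable_geometric suminf_geometric)
  have "R d t = (\<Sum>s. d * a s + d * \<mu> * c ^ s)"
    by (simp only: limit_opinion_eq[OF d] layer)
  also have "\<dots> = d * (\<Sum>s. a s) + d * \<mu> * (1 / (1 - c))"
    using sa sc by (simp add: suminf_add[symmetric] suminf_mult summable_mult)
  also have "(\<Sum>s. a s) = Y [] t + S t"
  proof -
    have "S t = (\<Sum>s. a (Suc s))"
      by (simp only: S_def a_def)
    moreover have "a 0 = Y [] t"
      by (simp add: a_def gw_layer_0 path_weight_Nil)
    ultimately show ?thesis
      using suminf_split_head[OF sa] by simp
  qed
  also have "d * (Y [] t + S t) + d * \<mu> * (1 / (1 - c)) = d * Z [] 0 t + c * \<mu> + d * S t"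
  proof -
    have "d = 1 - c"
      using d by simp
    show ?thesis
      unfolding \<open>d = 1 - c\<close> using c by (simp add: field_simps)
  qed
  finally show ?thesis .
qed

section \<open>Conditioning on the root mark\<close>

abbreviation root_algebra :: "'t measure" where
  "root_algebra \<equiv> vimage_algebra (space P) (X []) mark_algebra"

lemma X_root_measurable: "X [] \<in> root_algebra \<rightarrow>\<^sub>M mark_algebra"
  by (intro measurable_vimage_algebra1 funcsetI measurable_space[OF X_measurable])

text \<open>Conditioning is on the sigma-algebra generated by \<open>X []\<close> itself, while the
  moment identities are stated for \<open>marks_algebra {[]}\<close>. The inclusion makes indicators
  of root events admissible test functions.\<close>

lemma subalgebra_root_algebra: "subalgebra P root_algebra" "subalgebra (marks_algebra {[]}) root_algebra"
  using sets_image_in_sets[OF space_marks_algebra X_measurable_marks_algebra[of "[]" "{[]}"]]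
  by (auto simp: subalgebra_vimage_algebra subalgebra_def[of "marks_algebra _"])

lemma indicator_root_algebra: "A \<in> sets root_algebra \<Longrightarrow> indicator A \<in> bounded_measurable (marks_algebra {[]})"
  by (rule bounded_measurable_subalgebra[OF bounded_measurable_indicator subalgebra_root_algebra(2)])

lemma root_function: "g \<in> bounded_measurable mark_algebra \<Longrightarrow> (\<lambda>t. g (X [] t)) \<in> bounded_measurable root_algebra"
  by (rule bounded_measurable_compose[OF _ X_root_measurable])

lemma root_P: "g \<in> bounded_measurable mark_algebra \<Longrightarrow> (\<lambda>t. g (X i t)) \<in> bounded_measurable P"
  by (rule bounded_measurable_compose[OF _ X_measurable])

lemma real_cond_exp_Z_root: "AE t in P. real_cond_exp P root_algebra (Z [] k) t = m (X [] t)"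
proof (rule real_cond_exp_bounded[OF subalgebra_root_algebra(1) Z_bounded root_function[OF m]])
  fix A assume "A \<in> sets root_algebra"
  then have "indicator A \<in> bounded_measurable (marks_algebra UNIV)"
    using indicator_root_algebra marks_algebra_mono by blast
  then show "expectation (\<lambda>t. indicator A t * Z [] k t) = expectation (\<lambda>t. indicator A t * m (X [] t))"
    by (rule expectation_Z)
qed

lemma expectation_root_centered_sq:
  assumes H: "H \<in> bounded_measurable (marks_algebra {[]})"
  shows "expectation (\<lambda>t. H t * (Z [] k t - m (X [] t))\<^sup>2) = expectation (\<lambda>t. H t * (q (X [] t) - (m (X [] t))\<^sup>2))"
proof -
  have HU: "H \<in> bounded_measurable (marks_algebra UNIV)"
    using H by (rule marks_algebra_mono) simp
  have Hm: "(\<lambda>t. H t * m (X [] t)) \<in> bounded_measurable (marks_algebra UNIV)"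
    by (intro bounded_measurable_mult HU mark_function_in_marks_algebra[OF m]) simp
  note bm = integrable_bounded_measurable bounded_measurable_mult bounded_measurable_power bounded_measurable_diff
      bounded_measurable_add marks_algebra_P[OF H] Z_bounded root_P[OF m] root_P[OF q]
  have "expectation (\<lambda>t. H t * (Z [] k t - m (X [] t))\<^sup>2)
      = expectation (\<lambda>t. H t * (Z [] k t)\<^sup>2 - 2 * (H t * m (X [] t) * Z [] k t) + H t * (m (X [] t))\<^sup>2)"
    by (simp add: algebra_simps power2_eq_square)
  also have "\<dots> = expectation (\<lambda>t. H t * (Z [] k t)\<^sup>2) - 2 * expectation (\<lambda>t. H t * m (X [] t) * Z [] k t)
      + expectation (\<lambda>t. H t * (m (X [] t))\<^sup>2)"
    by (simp add: bm)
  also have "\<dots> = expectation (\<lambda>t. H t * q (X [] t)) - 2 * expectation (\<lambda>t. H t * m (X [] t) * m (X [] t))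
      + expectation (\<lambda>t. H t * (m (X [] t))\<^sup>2)"
    unfolding expectation_Z_sq[OF HU] expectation_Z[OF Hm] ..
  also have "\<dots> = expectation (\<lambda>t. H t * q (X [] t) - 2 * (H t * m (X [] t) * m (X [] t)) + H t * (m (X [] t))\<^sup>2)"
    by (simp add: bm)
  also have "\<dots> = expectation (\<lambda>t. H t * (q (X [] t) - (m (X [] t))\<^sup>2))"
    by (simp add: algebra_simps power2_eq_square)
  finally show ?thesis .
qed

lemma cond_variance_Z_root:
  "AE t in P. cond_variance P root_algebra (Z [] k) t = q (X [] t) - (m (X [] t))\<^sup>2"
proof -
  let ?F = root_algebra
  interpret FF: sigma_finite_subalgebra P ?F
    by (rule sigma_finite_subalgebraI[OF subalgebra_root_algebra(1)])
  have bm: "(\<lambda>t. (Z [] k t - m (X [] t))\<^sup>2) \<in> bounded_measurable P"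
    by (intro bounded_measurable_power bounded_measurable_diff Z_bounded root_P m)
  \<comment> \<open>\<open>cond_variance\<close> centers at a version of the conditional mean, which
    agrees with \<open>m (X [])\<close> only almost surely; the outer conditional expectation does
    not see the difference.\<close>
  have "AE t in P. cond_variance P ?F (Z [] k) t = real_cond_exp P ?F (\<lambda>t. (Z [] k t - m (X [] t))\<^sup>2) t"
    unfolding cond_variance_def
  proof (rule FF.real_cond_exp_cong)
    show "AE t in P. (Z [] k t - real_cond_exp P ?F (Z [] k) t)\<^sup>2 = (Z [] k t - m (X [] t))\<^sup>2"
      using real_cond_exp_Z_root[of k] by eventually_elim simp
  qed (simp, rule bounded_measurableD[OF bm])
  moreover have "AE t in P. real_cond_exp P ?F (\<lambda>t. (Z [] k t - m (X [] t))\<^sup>2) t = q (X [] t) - (m (X [] t))\<^sup>2"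
    by (rule real_cond_exp_bounded[OF subalgebra_root_algebra(1) bm])
      (intro bounded_measurable_diff bounded_measurable_power root_function m q,
       rule expectation_root_centered_sq[OF indicator_root_algebra])
  ultimately show ?thesis
    by eventually_elim simp
qed

context
  fixes d :: real
  assumes d: "c + d = 1" and deg: "AE t in P. \<forall>i. mark_deg (X i t) > 0"
begin

lemma AE_limit_opinion: "AE t in P. R d t = d * Z [] 0 t + c * \<mu> + d * S t"
  using deg AE_space by eventually_elim (rule limit_opinion_decomposition[OF d], auto)

lemma real_cond_exp_limit_opinion: "AE t in P. real_cond_exp P root_algebra (R d) t = d * m (X [] t) + c * \<mu>"
proof -
  let ?F = root_algebra
  interpret FF: sigma_finite_subalgebra P ?F
    by (rule sigma_finite_subalgebraI[OF subalgebra_root_algebra(1)])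
  let ?R = "\<lambda>t. d * Z [] 0 t + c * \<mu> + d * S t"
  have bm: "?R \<in> bounded_measurable P"
    by (intro bounded_measurable_add bounded_measurable_mult bounded_measurable_const Z_bounded S_bounded)
  have "AE t in P. real_cond_exp P ?F (R d) t = real_cond_exp P ?F ?R t"
    by (rule FF.real_cond_exp_cong[OF AE_limit_opinion limit_opinion_measurable[OF d] bounded_measurableD[OF bm]])
  moreover have "AE t in P. real_cond_exp P ?F ?R t = d * m (X [] t) + c * \<mu>"
  proof (rule real_cond_exp_bounded[OF subalgebra_root_algebra(1) bm])
    show "(\<lambda>t. d * m (X [] t) + c * \<mu>) \<in> bounded_measurable ?F"
      by (intro bounded_measurable_add bounded_measurable_mult bounded_measurable_const root_function m)
    fix A assume A: "A \<in> sets ?F"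
    let ?H = "indicator A :: 't \<Rightarrow> real"
    note H = indicator_root_algebra[OF A]
    have HU: "?H \<in> bounded_measurable (marks_algebra UNIV)"
      using H by (rule marks_algebra_mono) simp
    note bm = integrable_bounded_measurable bounded_measurable_mult bounded_measurable_add
      marks_algebra_P[OF H] Z_bounded S_bounded root_P[OF m]
    have "expectation (\<lambda>t. ?H t * ?R t)
        = expectation (\<lambda>t. d * (?H t * Z [] 0 t) + c * \<mu> * ?H t + d * (?H t * S t))"
      by (simp add: algebra_simps)
    also have "\<dots> = d * expectation (\<lambda>t. ?H t * Z [] 0 t) + c * \<mu> * expectation ?H + d * expectation (\<lambda>t. ?H t * S t)"
      by (simp add: bm)
    also have "\<dots> = d * expectation (\<lambda>t. ?H t * m (X [] t)) + c * \<mu> * expectation ?H"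
      by (simp only: expectation_Z[OF HU] expectation_S(1)[OF H] mult_zero_right add_0_right)
    also have "\<dots> = expectation (\<lambda>t. d * (?H t * m (X [] t)) + c * \<mu> * ?H t)"
      by (simp add: bm)
    also have "\<dots> = expectation (\<lambda>t. ?H t * (d * m (X [] t) + c * \<mu>))"
      by (simp add: algebra_simps)
    finally show "expectation (\<lambda>t. ?H t * ?R t) = expectation (\<lambda>t. ?H t * (d * m (X [] t) + c * \<mu>))" .
  qed
  ultimately show ?thesis
    by eventually_elim simp
qed

lemma cond_variance_limit_opinion:
  "AE t in P. cond_variance P root_algebra (R d) t
     = d\<^sup>2 * (q (X [] t) - (m (X [] t))\<^sup>2) + d\<^sup>2 / (1 - \<rho>) * wsq_deg [] t * \<sigma>2"
proof -
  let ?F = root_algebra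
  interpret FF: sigma_finite_subalgebra P ?F
    by (rule sigma_finite_subalgebraI[OF subalgebra_root_algebra(1)])
  \<comment> \<open>The root signal centered conditionally on the root mark. Subtracting the
    conditional mean from the opinion cancels \<open>c * \<mu>\<close> and leaves
    \<open>d * U + d * S\<close>.\<close>
  define U where "U t = Z [] 0 t - m (X [] t)" for t
  have U: "U \<in> bounded_measurable P"
    unfolding U_def[abs_def] by (intro bounded_measurable_diff Z_bounded root_P m)
  let ?V = "\<lambda>t. (d * U t + d * S t)\<^sup>2"
  have bm: "?V \<in> bounded_measurable P"
    by (intro bounded_measurable_power bounded_measurable_add bounded_measurable_mult bounded_measurable_const U S_bounded)
  have "AE t in P. cond_variance P ?F (R d) t = real_cond_exp P ?F ?V t"
    unfolding cond_variance_def
  proof (rule FF.real_cond_exp_cong)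
    show "AE t in P. (R d t - real_cond_exp P ?F (R d) t)\<^sup>2 = ?V t"
      using AE_limit_opinion real_cond_exp_limit_opinion
      by eventually_elim (simp add: U_def algebra_simps)
    show "(\<lambda>t. (R d t - real_cond_exp P ?F (R d) t)\<^sup>2) \<in> borel_measurable P"
      using limit_opinion_measurable[OF d] by simp
  qed (rule bounded_measurableD[OF bm])
  moreover have "AE t in P. real_cond_exp P ?F ?V t
     = d\<^sup>2 * (q (X [] t) - (m (X [] t))\<^sup>2) + d\<^sup>2 / (1 - \<rho>) * wsq_deg [] t * \<sigma>2"
  proof (rule real_cond_exp_bounded[OF subalgebra_root_algebra(1) bm])
    have wsq: "(\<lambda>x :: 'a mark. \<Sum>r<mark_deg x. (mark_weight x r)\<^sup>2) \<in> borel_measurable mark_algebra"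
      by (rule measurable_sum_lessThan_mark_deg) measurable
    have wsq_root: "wsq_deg [] \<in> bounded_measurable ?F"
    proof (rule bounded_measurableI[of _ _ c])
      show "wsq_deg [] \<in> borel_measurable ?F"
        by (rule measurable_compose[OF X_root_measurable wsq])
      show "\<bar>wsq_deg [] t\<bar> \<le> c" if "t \<in> space ?F" for t
        using wsq_bounds[of t "[]" "mark_deg (X [] t)"] that by simp
    qed
    show "(\<lambda>t. d\<^sup>2 * (q (X [] t) - (m (X [] t))\<^sup>2) + d\<^sup>2 / (1 - \<rho>) * wsq_deg [] t * \<sigma>2) \<in> bounded_measurable ?F"
      by (intro wsq_root bounded_measurable_add bounded_measurable_diff bounded_measurable_power bounded_measurable_mult
          bounded_measurable_const root_function m q)
    fix A assume A: "A \<in> sets ?F"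
    let ?H = "indicator A :: 't \<Rightarrow> real"
    note H = indicator_root_algebra[OF A]
    note bm = integrable_bounded_measurable bounded_measurable_mult bounded_measurable_add bounded_measurable_diff
      bounded_measurable_power marks_algebra_P[OF H] U S_bounded root_P[OF m] root_P[OF q]
      bounded_measurable_subalgebra[OF wsq_root subalgebra_root_algebra(1)]
    have "expectation (\<lambda>t. ?H t * ?V t)
        = expectation (\<lambda>t. d\<^sup>2 * (?H t * (U t)\<^sup>2) + 2 * d\<^sup>2 * (?H t * (U t * S t)) + d\<^sup>2 * (?H t * (S t)\<^sup>2))"
      by (simp add: algebra_simps power2_eq_square)
    also have "\<dots> = d\<^sup>2 * expectation (\<lambda>t. ?H t * (U t)\<^sup>2) + 2 * d\<^sup>2 * expectation (\<lambda>t. ?H t * (U t * S t))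
        + d\<^sup>2 * expectation (\<lambda>t. ?H t * (S t)\<^sup>2)"
      by (simp add: bm)
    \<comment> \<open>The mixed term of \<open>U\<close> and \<open>S\<close> vanishes by the second
      part of \<open>expectation_S\<close>, so the variances of root and descendants add.\<close>
    also have "\<dots> = d\<^sup>2 * expectation (\<lambda>t. ?H t * (q (X [] t) - (m (X [] t))\<^sup>2))
        + d\<^sup>2 * (\<sigma>2 * (expectation (\<lambda>t. ?H t * wsq_deg [] t) / (1 - \<rho>)))"
      unfolding U_def expectation_root_centered_sq[OF H] expectation_S(2,3)[OF H] by simp
    also have "\<dots> = d\<^sup>2 * expectation (\<lambda>t. ?H t * (q (X [] t) - (m (X [] t))\<^sup>2))
        + (d\<^sup>2 / (1 - \<rho>) * \<sigma>2) * expectation (\<lambda>t. ?H t * wsq_deg [] t)"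
      by simp
    also have "\<dots> = expectation (\<lambda>t. d\<^sup>2 * (?H t * (q (X [] t) - (m (X [] t))\<^sup>2))
        + (d\<^sup>2 / (1 - \<rho>) * \<sigma>2) * (?H t * wsq_deg [] t))"
      by (subst Bochner_Integration.integral_add) (simp_all add: bm)
    also have "\<dots> = expectation (\<lambda>t. ?H t * (d\<^sup>2 * (q (X [] t) - (m (X [] t))\<^sup>2) + d\<^sup>2 / (1 - \<rho>) * wsq_deg [] t * \<sigma>2))"
      by (intro Bochner_Integration.integral_cong refl) (simp only: distrib_left ac_simps)
    finally show "expectation (\<lambda>t. ?H t * ?V t)
        = expectation (\<lambda>t. ?H t * (d\<^sup>2 * (q (X [] t) - (m (X [] t))\<^sup>2) + d\<^sup>2 / (1 - \<rho>) * wsq_deg [] t * \<sigma>2))" .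
  qed
  ultimately show ?thesis
    by eventually_elim simp
qed

end

end

theorem proposition5:
  fixes c d K :: real
    and M :: "nat \<Rightarrow> 'w measure"
    and G :: "nat \<Rightarrow> 'w \<Rightarrow> (nat, 'a::polish_space mark) mgraph"
    and W :: "nat \<Rightarrow> nat \<Rightarrow> nat \<Rightarrow> 'w \<Rightarrow> real"
    and P :: "'t measure"
    and X :: "nat list \<Rightarrow> 't \<Rightarrow> 'a mark"
    and Z :: "nat list \<Rightarrow> nat \<Rightarrow> 't \<Rightarrow> real"
    and \<nu> :: "'a mark \<Rightarrow> real measure"
    and k :: nat
  defines "R \<equiv> \<lambda>t. limit_opinion c d (\<lambda>i. X i t) (\<lambda>i s. media_signal c d X Z i s t)"
    and "F \<equiv> vimage_algebra (space P) (X []) mark_algebra"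
    and "\<rho>\<^sub>2 \<equiv> \<integral>t. (\<Sum>r<mark_deg (X [0] t). (mark_weight (X [0] t) r)\<^sup>2) \<partial>P"
  assumes "0 \<le> c" "c < 1" "0 < d" "d \<le> 1" "c + d = 1"
    and "\<And>n. n \<ge> 1 \<Longrightarrow> vertex_weighted_digraph c n (M n) (G n)"
    and "gw_marks c P X"
    and "strong_coupling (\<lambda>n. distr (M n) mgraph_algebra (G n))
           [] (distr P mgraph_algebra (\<lambda>t. gw_graph (\<lambda>i. X i t)))"
    and "\<nu> \<in> mark_algebra \<rightarrow>\<^sub>M prob_algebra borel"
    and "\<And>x y. x \<in> mark_space \<Longrightarrow> y \<in> mark_space \<Longrightarrow>
           wasserstein1 (\<nu> x) (\<nu> y) \<le> ennreal (K * mark_dist x y)"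
    and "\<And>n. n \<ge> 1 \<Longrightarrow> graph_signals c d \<nu> n (M n) (G n) (W n)"
    and "media_signals c d \<nu> P X Z"
    and "\<P>(t in P. mark_deg (X [] t) > 0) = 1"
    and "\<P>(t in P. mark_deg (X [0] t) > 0) = 1"
  shows "(AE t in P. real_cond_exp P F R t
            = d * real_cond_exp P F (Z [] k) t + c * prob_space.expectation P (Z [0] k))
       \<and> (AE t in P. cond_variance P F R t
            = d\<^sup>2 * cond_variance P F (Z [] k) t
              + d\<^sup>2 / (1 - \<rho>\<^sub>2) * (\<Sum>r<mark_deg (X [] t). (mark_weight (X [] t) r)\<^sup>2)
                * prob_space.variance P (Z [0] k))"
proof -
  have F: "F = vimage_algebra (space P) (X []) mark_algebra"
    and R: "R = (\<lambda>t. limit_opinion c d (\<lambda>i. X i t) (\<lambda>i s. media_signal c d X Z i s t))"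
    and \<rho>: "\<rho>\<^sub>2 = (\<integral>t. (\<Sum>r<mark_deg (X [0] t). (mark_weight (X [0] t) r)\<^sup>2) \<partial>P)"
    by (simp_all only: F_def R_def \<rho>\<^sub>2_def)
  interpret P: prob_space P
    using \<open>gw_marks c P X\<close> by (simp add: gw_marks_def)
  interpret T: gw_tree P c X
    by unfold_locales fact+
  obtain m q where "gw_signals P c X Z m q"
    using T.gw_signals_of_media[OF \<open>0 < d\<close> \<open>c + d = 1\<close> \<open>\<nu> \<in> mark_algebra \<rightarrow>\<^sub>M prob_algebra borel\<close>
        \<open>media_signals c d \<nu> P X Z\<close>] by blast
  then interpret gw_signals P c X Z m q .
  have deg: "AE t in P. \<forall>i. mark_deg (X i t) > 0"
    by (rule T.AE_mark_deg_pos) fact+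
  \<comment> \<open>The opinion contains the root signal of time 0, the claim that of time
    \<open>k\<close>. As \<open>m\<close> and \<open>q\<close> serve all times, both have the same
    conditional moments, and \<open>m\<close> and \<open>q\<close> drop out of the final
    formulas.\<close>
  have "AE t in P. real_cond_exp P F R t
      = d * real_cond_exp P F (Z [] k) t + c * prob_space.expectation P (Z [0] k)"
    using real_cond_exp_limit_opinion[OF \<open>c + d = 1\<close> deg] real_cond_exp_Z_root[of k]
    unfolding F R by eventually_elim (simp add: expectation_Z_nonroot)
  moreover have "AE t in P. cond_variance P F R t
      = d\<^sup>2 * cond_variance P F (Z [] k) t
        + d\<^sup>2 / (1 - \<rho>\<^sub>2) * (\<Sum>r<mark_deg (X [] t). (mark_weight (X [] t) r)\<^sup>2)
          * prob_space.variance P (Z [0] k)"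
    using cond_variance_limit_opinion[OF \<open>c + d = 1\<close> deg] cond_variance_Z_root[of k]
    unfolding F R \<rho> by eventually_elim (simp add: variance_Z_nonroot)
  ultimately show ?thesis ..
qed

end
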